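(* Let $k\geqslant1$ be an integer and $\lambda\in\left(\frac13,1\right)$. Then there exists $\boldsymbol{\alpha}\in\mathbb{R}^3$ such that the word of patterns $\mathfrak{W}(\boldsymbol{\alpha})$ is ultimately periodic with period $A^kB$ ($k$ letters $A$ followed by one letter $B$), and $$\hat{\omega}(\boldsymbol{\alpha})=\lambda,\qquad \frac{\omega(\boldsymbol{\alpha})}{\hat{\omega}(\boldsymbol{\alpha})}=\mathfrak{g}_k(\lambda).$$
   Context: Exponents: for $\boldsymbol{\alpha}\in\mathbb{R}^3$, $\omega(\boldsymbol{\alpha})$ is the supremum of $\gamma$ such that the system $\max_{1\le j\le 3}|q\alpha_j-a_j|\leqslant Q^{-\gamma}$, $1\leqslant q\leqslant Q$ has a solution $(q,a_1,a_2,a_3)\in\mathbb{Z}^4$ for arbitrarily large $Q$; $\hat{\omega}(\boldsymbol{\alpha})$ is the supremum of $\gamma$ such that this system has an integer solution for all sufficiently large $Q$. Best approximations: $|\cdot|$ is the Euclidean norm. The best approximation vectors of $\boldsymbol{\alpha}\notin\mathbb{Q}^3$ are the vectors $\mathbf{z}_\nu=(q_\nu,\mathbf{a}_\nu)\in\mathbb{Z}\times\mathbb{Z}^3$, $\nu\geqslant1$, with $1\le q_1<q_2<\cdots$, $\xi_\nu=|q_\nu\boldsymbol{\alpha}-\mathbf{a}_\nu|$ strictly decreasing, and $\xi_\nu=\min\{|q\boldsymbol{\alpha}-\mathbf{a}|: q\in\mathbb{Z},\,1\le q\le q_\nu,\,\mathbf{a}\in\mathbb{Z}^3\}$; they form the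 complete sequence of such successive minimal points. Patterns: call an index $\nu$ good if $\mathbf{z}_{\nu-1},\mathbf{z}_\nu,\mathbf{z}_{\nu+1}$ are linearly independent in $\mathbb{R}^4$. Let $\nu_1<\nu_2<\cdots$ be the (infinitely many) good indices. For each $i\ge1$ let $C_i=A$ if the three-dimensional spaces $\langle\mathbf{z}_{\nu_i-1},\mathbf{z}_{\nu_i},\mathbf{z}_{\nu_i+1}\rangle_{\mathbb{R}}$ and $\langle\mathbf{z}_{\nu_{i+1}-1},\mathbf{z}_{\nu_{i+1}},\mathbf{z}_{\nu_{i+1}+1}\rangle_{\mathbb{R}}$ coincide, and $C_i=B$ otherwise. The word of patterns is $\mathfrak{W}(\boldsymbol{\alpha})=C_1C_2C_3\ldots$. Parameters: $\theta=\frac{1-\lambda}{\lambda}$, $S_k=\sum_{j=0}^{k-1}\theta^j$ ($S_0=0$), and for $k\ge1$: $M_k=\theta S_{k+1}$, $N_k=2\theta^k+\frac{S_k}{\lambda}+\theta S_{k-1}$, $P_k=\frac{S_{k-1}}{\lambda}+\theta^{k-1}$, $R_k(g,\lambda)=M_kg^2-N_kg+P_k$; $\mathfrak{g}_k(\lambda)$ is the unique root of $R_k(g,\lambda)=0$ in the interval $(1,\frac{2}{\theta})$. *)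

theory Defs
  imports "HOL-Analysis.Analysis"
begin

section \<open>Exponents\<close>

definition err :: "real ^ 3 \<Rightarrow> int \<Rightarrow> int ^ 3 \<Rightarrow> real ^ 3" where
  "err \<alpha> q a = (\<chi> j. of_int q * \<alpha> $ j - of_int (a $ j))"

definition approx_solvable :: "real ^ 3 \<Rightarrow> real \<Rightarrow> real \<Rightarrow> bool" where
  "approx_solvable \<alpha> \<gamma> Q \<longleftrightarrow>
     (\<exists>(q::int) (a::int ^ 3). 1 \<le> q \<and> of_int q \<le> Q \<and>
        (MAX j\<in>UNIV. \<bar>err \<alpha> q a $ j\<bar>) \<le> Q powr (- \<gamma>))"

text \<open>The exponents are extended reals because \<open>omega\<close> may be infinite.\<close>

definition omega :: "real ^ 3 \<Rightarrow> ereal" where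
  "omega \<alpha> = (SUP \<gamma>\<in>{\<gamma>. \<exists>\<^sub>F Q in at_top. approx_solvable \<alpha> \<gamma> Q}. ereal \<gamma>)"

definition omega_hat :: "real ^ 3 \<Rightarrow> ereal" where
  "omega_hat \<alpha> = (SUP \<gamma>\<in>{\<gamma>. \<forall>\<^sub>F Q in at_top. approx_solvable \<alpha> \<gamma> Q}. ereal \<gamma>)"

section \<open>Best approximations\<close>

definition rational_point :: "real ^ 3 \<Rightarrow> bool" where
  "rational_point \<alpha> \<longleftrightarrow> (\<forall>j. \<alpha> $ j \<in> \<rat>)"

text \<open>Sequences are indexed from 0, so \<open>z n\<close> is the vector usually written
  \<open>z\<close> with index \<open>n + 1\<close>. The last conjunct is completeness: the denominator of every
  minimal point that improves on all smaller denominators occurs in the sequence.\<close>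

definition best_approximations :: "real ^ 3 \<Rightarrow> (nat \<Rightarrow> int \<times> (int ^ 3)) \<Rightarrow> bool" where
  "best_approximations \<alpha> z \<longleftrightarrow>
     (let q = (\<lambda>n. fst (z n)); \<xi> = (\<lambda>n. norm (err \<alpha> (fst (z n)) (snd (z n)))) in
        1 \<le> q 0 \<and> strict_mono q \<and> (\<forall>m n. m < n \<longrightarrow> \<xi> n < \<xi> m) \<and>
        (\<forall>n q' a'. 1 \<le> q' \<and> q' \<le> q n \<longrightarrow> \<xi> n \<le> norm (err \<alpha> q' a')) \<and>
        (\<forall>p b. 1 \<le> p \<and> (\<forall>a'. norm (err \<alpha> p b) \<le> norm (err \<alpha> p a')) \<and>
               (\<forall>q' a'. 1 \<le> q' \<and> q' < p \<longrightarrow> norm (err \<alpha> p b) < norm (err \<alpha> q' a'))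
           \<longrightarrow> p \<in> range q))"

text \<open>For a point that is not rational such a sequence exists. It is unique unless some
  \<open>q \<alpha>\<^sub>j\<close> lies halfway between two integers; in particular it is unique
  when all coordinates are irrational.\<close>

definition best_approx :: "real ^ 3 \<Rightarrow> nat \<Rightarrow> int \<times> (int ^ 3)" where
  "best_approx \<alpha> = (SOME z. best_approximations \<alpha> z)"

section \<open>Patterns\<close>

text \<open>The four-dimensional real space is represented as \<open>real \<times> (real ^ 3)\<close>.\<close>

definition best_vec :: "real ^ 3 \<Rightarrow> nat \<Rightarrow> real \<times> (real ^ 3)" where
  "best_vec \<alpha> n = (of_int (fst (best_approx \<alpha> n)), \<chi> j. of_int (snd (best_approx \<alpha> n) $ j))"

definition triple :: "real ^ 3 \<Rightarrow> nat \<Rightarrow> (real \<times> (real ^ 3)) set" where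
  "triple \<alpha> n = {best_vec \<alpha> (n - 1), best_vec \<alpha> n, best_vec \<alpha> (n + 1)}"

text \<open>The first coordinates of best approximations increase strictly, so for \<open>1 \<le> n\<close>
  the set \<open>triple \<alpha> n\<close> has three elements.\<close>

definition good_indices :: "real ^ 3 \<Rightarrow> nat set" where
  "good_indices \<alpha> = {n. 1 \<le> n \<and> independent (triple \<alpha> n)}"

datatype letter = Letter_A | Letter_B

text \<open>Meaningful only if \<open>good_indices \<alpha>\<close> is infinite.\<close>

definition pattern_word :: "real ^ 3 \<Rightarrow> nat \<Rightarrow> letter" where
  "pattern_word \<alpha> i =
     (if span (triple \<alpha> (enumerate (good_indices \<alpha>) i))
         = span (triple \<alpha> (enumerate (good_indices \<alpha>) (i + 1)))
      then Letter_A else Letter_B)"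

definition ultimately_periodic :: "(nat \<Rightarrow> 'a) \<Rightarrow> 'a list \<Rightarrow> bool" where
  "ultimately_periodic w p \<longleftrightarrow> (\<exists>m. \<forall>j. w (m + j) = p ! (j mod length p))"

section \<open>Parameters\<close>

definition theta :: "real \<Rightarrow> real" where
  "theta l = (1 - l) / l"

definition S_sum :: "nat \<Rightarrow> real \<Rightarrow> real" where
  "S_sum k l = (\<Sum>j<k. theta l ^ j)"

definition M_coeff :: "nat \<Rightarrow> real \<Rightarrow> real" where
  "M_coeff k l = theta l * S_sum (k + 1) l"

definition N_coeff :: "nat \<Rightarrow> real \<Rightarrow> real" where
  "N_coeff k l = 2 * theta l ^ k + S_sum k l / l + theta l * S_sum (k - 1) l"

definition P_coeff :: "nat \<Rightarrow> real \<Rightarrow> real" where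
  "P_coeff k l = S_sum (k - 1) l / l + theta l ^ (k - 1)"

definition R_poly :: "nat \<Rightarrow> real \<Rightarrow> real \<Rightarrow> real" where
  "R_poly k g l = M_coeff k l * g\<^sup>2 - N_coeff k l * g + P_coeff k l"

definition g_root :: "nat \<Rightarrow> real \<Rightarrow> real" where
  "g_root k l = (THE g. 1 < g \<and> g < 2 / theta l \<and> R_poly k g l = 0)"

end

theory Submission
  imports Defs
begin

text \<open>
  The best approximations are produced by the recursion
  \<open>Z (n + 1) = c n Z n - Z (old n)\<close>, started from \<open>(1, 0)\<close> and three vectors
  \<open>(0, - f)\<close>, where \<open>f\<close> runs over a basis of the integer lattice in three-space whose
  members have pairwise negative inner products. At every stage \<open>Z n\<close> and three earlier vectors form
  a basis of the integer lattice in four-space, and \<open>Z (old n)\<close> is the one of these three that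
  \<open>Z (n + 1)\<close> replaces. Choosing \<open>old n = n - 2\<close> keeps the next vector in the space spanned
  by the last three (letter A); replacing the fourth vector leaves that space (letter B).

  The error of \<open>Z (old n)\<close> is \<open>c n\<close> times the error of \<open>Z n\<close> up to a much smaller term, so
  each error stays close to a positive multiple of one of the three vectors \<open>f\<close>. Hence the only integer
  combinations that could compete with \<open>Z n\<close> before \<open>Z (n + 1)\<close> lie in the plane of these two
  vectors, and there the obtuse angle between consecutive errors excludes \<open>Z (n + 1) - Z n\<close>.

  It remains to choose the multipliers \<open>c n\<close>. With \<open>x\<close> standing for the logarithms of the
  denominators and \<open>lam * x (n + 1)\<close> for minus the logarithm of the \<open>n\<close>-th error, the recursion
  becomes \<open>lam * (x (n + 1) - x (old n + 1)) = x (n + 1) - x n\<close>. It has a solution whose quotients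
  \<open>x (n + 1) / x n\<close> are periodic with period \<open>k + 1\<close> and maximum \<open>g\<close> exactly when
  \<open>R_poly k g lam = 0\<close>.
\<close>

section \<open>Logarithms of the denominators\<close>

lemma theta_bounds:
  assumes "lam \<in> {1/3 <..< 1}"
  shows "0 < theta lam" "theta lam < 2" "1 / lam = 1 + theta lam"
  using assms by (auto simp: theta_def field_simps)

lemma S_sum_Suc: "S_sum (Suc k) l = S_sum k l + theta l ^ k"
  by (simp add: S_sum_def)

lemma S_sum_Suc_left: "S_sum (Suc k) l = 1 + theta l * S_sum k l"
  unfolding S_sum_def sum.lessThan_Suc_shift sum_distrib_left by simp

lemma S_sum_nonneg: "0 \<le> theta l \<Longrightarrow> 0 \<le> S_sum k l"
  by (simp add: S_sum_def sum_nonneg)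

text \<open>The two brackets are \<open>\<theta> ^ k * t (Suc k)\<close> and
  \<open>\<theta> ^ (k - 1) * t k\<close> for the sequence \<open>t\<close> in
  \<open>log_denominators_exist\<close>; in this form a root of \<open>R_poly\<close> is the
  condition that closes the period there.\<close>

lemma R_poly_factor:
  assumes "k \<ge> 1" "lam \<in> {1/3 <..< 1}"
  defines "\<theta> \<equiv> theta lam"
  shows "R_poly k g lam =
    (\<theta> * g - 1) * (\<theta> ^ k + (g - 1) * S_sum (Suc k) lam) - \<theta> * (\<theta> ^ (k - 1) + (g - 1) * S_sum k lam)"
proof -
  obtain m where k: "k = Suc m" using assms(1) by (cases k) auto
  define s where "s = S_sum m lam"
  define u where "u = \<theta> ^ m"
  have S: "S_sum (Suc m) lam = s + u" "S_sum (Suc (Suc m)) lam = s + u + \<theta> * u"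
    by (auto simp: S_sum_Suc s_def u_def \<theta>_def)
  have s: "\<theta> * s = s + u - 1"
    using S_sum_Suc_left[of m lam] unfolding S by (simp add: s_def \<theta>_def)
  have "x / lam = x * (1 + \<theta>)" for x
    using theta_bounds(3)[OF assms(2)] by (metis \<theta>_def divide_inverse mult.right_neutral times_divide_eq_right)
  then have "R_poly k g lam = \<theta> * (s + u + \<theta> * u) * g\<^sup>2
      - (2 * (\<theta> * u) + (s + u) * (1 + \<theta>) + \<theta> * s) * g + (s * (1 + \<theta>) + u)"
    unfolding R_poly_def M_coeff_def N_coeff_def P_coeff_def k
    by (simp add: S flip: s_def u_def \<theta>_def)
  also have "\<dots> = (\<theta> * g - 1) * (\<theta> * u + (g - 1) * (s + u + \<theta> * u)) - \<theta> * (u + (g - 1) * (s + u))"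
    by (simp add: power2_eq_square algebra_simps)
  finally show ?thesis by (simp add: k S flip: u_def)
qed

text \<open>The values are \<open>(\<theta> - 2) * \<theta> ^ k\<close> at 1 and
  \<open>2 / \<theta> - 1\<close> at the other end, so both signs come from
  \<open>0 < \<theta> < 2\<close>. Together with the leading coefficient they pin down
  \<open>g_root\<close>.\<close>

lemma R_poly_bounds:
  assumes "k \<ge> 1" "lam \<in> {1/3 <..< 1}"
  shows "R_poly k 1 lam < 0" "R_poly k (2 / theta lam) lam > 0" "M_coeff k lam > 0"
proof -
  define \<theta> where "\<theta> = theta lam"
  note th = theta_bounds[OF assms(2), folded \<theta>_def]
  obtain m where k: "k = Suc m" using assms(1) by (cases k) auto
  define s where "s = S_sum m lam"
  define u where "u = \<theta> ^ m"
  have u: "u > 0" using th by (simp add: u_def)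
  have S: "S_sum (Suc m) lam = s + u" "S_sum (Suc (Suc m)) lam = s + u + \<theta> * u"
    by (auto simp: S_sum_Suc s_def u_def \<theta>_def)
  have s: "\<theta> * s = s + u - 1"
    using S_sum_Suc_left[of m lam] unfolding S by (simp add: s_def \<theta>_def)
  have s0: "s \<ge> 0" unfolding s_def using th by (intro S_sum_nonneg) (simp flip: \<theta>_def)
  have "R_poly k 1 lam = (\<theta> - 2) * (\<theta> * u)"
    unfolding R_poly_factor[OF assms] by (simp add: k algebra_simps flip: u_def \<theta>_def)
  also have "\<dots> < 0" using th u by (intro mult_neg_pos) auto
  finally show "R_poly k 1 lam < 0" .
  have "R_poly k (2 / \<theta>) lam
      = \<theta> * u + (2 / \<theta> - 1) * (s + u + \<theta> * u) - (\<theta> * u + (2 - \<theta>) * (s + u))"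
    unfolding R_poly_factor[OF assms] using th
    by (simp add: k S flip: u_def \<theta>_def) (simp add: field_simps)
  also have "\<dots> = (2 / \<theta> - 1) * (s + u + \<theta> * u - \<theta> * (s + u))"
    using th by (simp add: field_simps)
  also have "s + u + \<theta> * u - \<theta> * (s + u) = 1" using s by (simp add: algebra_simps)
  finally show "R_poly k (2 / theta lam) lam > 0" using th by (simp flip: \<theta>_def)
  show "M_coeff k lam > 0" using th u s0
    unfolding M_coeff_def k by (simp add: S add_nonneg_pos flip: \<theta>_def)
qed

lemma g_root_props:
  assumes "k \<ge> 1" "lam \<in> {1/3 <..< 1}"
  shows "1 < g_root k lam" "R_poly k (g_root k lam) lam = 0"
proof -
  let ?P = "\<lambda>g. 1 < g \<and> g < 2 / theta lam \<and> R_poly k g lam = 0"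
  note b = R_poly_bounds[OF assms] and th = theta_bounds[OF assms(2)]
  have "1 \<le> 2 / theta lam" using th by (simp add: field_simps)
  moreover have "continuous_on {1..2 / theta lam} (\<lambda>g. R_poly k g lam)"
    unfolding R_poly_def by (intro continuous_intros)
  ultimately obtain g where g: "1 \<le> g" "g \<le> 2 / theta lam" "R_poly k g lam = 0"
    using IVT'[of "\<lambda>g. R_poly k g lam" 1 0 "2 / theta lam"] b by auto
  have "g \<noteq> 1" "g \<noteq> 2 / theta lam" using g(3) b by auto
  with g have "?P g" by simp
  moreover have "g' = g" if "?P g'" for g'
  proof (rule ccontr)
    assume ne: "g' \<noteq> g"
    \<comment> \<open>Two distinct roots have the sum \<open>N_coeff / M_coeff\<close>. The value at
      1 is then \<open>M_coeff * (g' - 1) * (g - 1) > 0\<close>, against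
      \<open>R_poly_bounds\<close>.\<close>
    have "(g' - g) * (M_coeff k lam * (g' + g) - N_coeff k lam) = R_poly k g' lam - R_poly k g lam"
      unfolding R_poly_def by (simp add: algebra_simps power2_eq_square)
    then have N: "N_coeff k lam = M_coeff k lam * (g' + g)"
      using ne g that by simp
    then have "R_poly k 1 lam = M_coeff k lam * ((g' - 1) * (g - 1)) + R_poly k g lam"
      unfolding R_poly_def by (simp add: algebra_simps power2_eq_square)
    moreover have "M_coeff k lam * ((g' - 1) * (g - 1)) > 0"
      using b(3) that \<open>?P g\<close> by (intro mult_pos_pos) auto
    ultimately show False using g b by simp
  qed
  ultimately have "?P (g_root k lam)"
    unfolding g_root_def by (rule theI)
  then show "1 < g_root k lam" "R_poly k (g_root k lam) lam = 0" by auto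
qed

text \<open>Since \<open>1 / lam = 1 + \<theta>\<close>, the relation off the multiples of
  \<open>p\<close> says that successive increments have ratio \<open>1 / \<theta>\<close>. One
  period is therefore 1 plus a geometric sum with first increment \<open>g - 1\<close>, and the
  later periods are its multiples by powers of \<open>h\<close>. The relation at multiples of
  \<open>p\<close> is left as the one equation for \<open>g\<close>.\<close>

lemma log_denominators_exist:
  fixes k :: nat
  assumes k: "k \<ge> 1" and lam: "lam \<in> {1/3 <..< 1}"
  defines "g \<equiv> g_root k lam" and "p \<equiv> Suc k"
  obtains x :: "nat \<Rightarrow> real" and r :: real
  where "1 < r" "x 0 = 1" "\<And>n. r * x n \<le> x (Suc n)" "\<And>n. x (Suc n) \<le> g * x n"
    "\<And>n. p dvd n \<Longrightarrow> x (Suc n) = g * x n"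
    "\<And>n. \<not> p dvd n \<Longrightarrow> lam * (x (Suc n) - x (n - 1)) = x (Suc n) - x n"
    "\<And>n. p dvd n \<Longrightarrow> 2 * p \<le> n \<Longrightarrow> lam * (x (Suc n) - x (n - p - 1)) = x (Suc n) - x n"
proof -
  define \<theta> where "\<theta> = theta lam"
  note th = theta_bounds[OF lam, folded \<theta>_def]
  note g = g_root_props[OF k lam, folded g_def]
  define t where "t j = 1 + (g - 1) * (\<Sum>i<j. (1 / \<theta>) ^ i)" for j
  define h where "h = t p"
  define x where "x n = h ^ (n div p) * t (n mod p)" for n
  have t0: "t 0 = 1" and t1: "t (Suc 0) = g" by (simp_all add: t_def)
  have step: "t (Suc j) = t j + (g - 1) * (1 / \<theta>) ^ j" for j
    by (simp add: t_def algebra_simps)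
  have mono: "t j < t (Suc j)" for j using step[of j] g th by simp
  have pos: "t j \<ge> 1" for j by (induction j) (use t0 mono less_imp_le order_trans in \<open>auto, fastforce\<close>)
  have A: "\<theta> * (t (Suc (Suc j)) - t (Suc j)) = t (Suc j) - t j" for j
    using th by (simp add: step)
  have inv: "\<theta> * t (Suc j) - t j = \<theta> * g - 1" for j
  proof (induction j)
    case (Suc j) then show ?case using A[of j] by (simp add: algebra_simps)
  qed (simp add: t0 t1)
  have tS: "\<theta> ^ j * t (Suc j) = \<theta> ^ j + (g - 1) * S_sum (Suc j) lam" for j
  proof (induction j)
    case (Suc j)
    have "\<theta> ^ Suc j * ((g - 1) * (1 / \<theta>) ^ Suc j) = g - 1"
      using th by (simp add: power_one_over)
    then have "\<theta> ^ Suc j * t (Suc (Suc j)) = \<theta> * (\<theta> ^ j * t (Suc j)) + (g - 1)"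
      unfolding step[of "Suc j"] distrib_left by (simp add: algebra_simps)
    then show ?case unfolding Suc.IH S_sum_Suc_left[of "Suc j"] by (simp add: algebra_simps flip: \<theta>_def)
  qed (simp add: t1 S_sum_def)
  \<comment> \<open>By \<open>R_poly_factor\<close> and \<open>tS\<close> this is
    \<open>R_poly k g lam = 0\<close> divided by \<open>\<theta> ^ k\<close>.\<close>
  have B: "(\<theta> * g - 1) * h = t k"
  proof -
    obtain m where m: "k = Suc m" using k by (cases k) auto
    have "(\<theta> * g - 1) * (\<theta> ^ k * t (Suc k)) = \<theta> * (\<theta> ^ m * t k)"
      using g(2) R_poly_factor[OF k lam, of g] tS[of m] tS[of "Suc m"] by (simp add: m flip: \<theta>_def)
    then have "\<theta> ^ k * ((\<theta> * g - 1) * h) = \<theta> ^ k * t k"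
      unfolding h_def p_def by (simp add: m algebra_simps)
    then show ?thesis using th by simp
  qed
  have h1: "h > 1" using mono[of k] pos[of k] by (simp add: h_def p_def)
  have tg: "\<theta> * g > 1"
  proof -
    have "(\<theta> * g - 1) * h > 0" using B pos[of k] by simp
    then show ?thesis using h1 by (simp add: zero_less_mult_iff)
  qed
  \<comment> \<open>The relation at multiples of \<open>p\<close> reaches back two periods, hence
    two factors \<open>h\<close>. One comes from \<open>B\<close>, the other from \<open>B\<close>
    and \<open>inv\<close> at \<open>k\<close>.\<close>
  have B2: "t k = h * (h * (1 + \<theta> - \<theta> * g))"
  proof -
    have "h * (1 + \<theta> - \<theta> * g) = \<theta> * g - 1"
      using inv[of k] B by (simp add: h_def p_def algebra_simps)
    then show ?thesis using B by (metis mult.commute)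
  qed
  have xSuc: "x (Suc n) = h ^ (n div p) * t (Suc (n mod p))" for n
  proof (cases "Suc (n mod p) = p")
    case True
    then have "Suc n mod p = 0" "Suc n div p = Suc (n div p)" by (auto simp: mod_Suc div_Suc)
    then show ?thesis by (simp add: x_def True t0 flip: h_def)
  next
    case False
    then show ?thesis by (simp add: x_def mod_Suc div_Suc)
  qed
  \<comment> \<open>By \<open>inv\<close> the quotient \<open>t (Suc j) / t j\<close> is
    \<open>(1 + (\<theta> * g - 1) / t j) / \<theta>\<close>. It is largest for
    \<open>t j = 1\<close>, where it equals \<open>g\<close>.\<close>
  have tle: "t (Suc j) \<le> g * t j" for j
  proof -
    have "0 \<le> (\<theta> * g - 1) * (t j - 1)" using tg pos[of j] by simp
    then have "\<theta> * t (Suc j) \<le> \<theta> * (g * t j)" using inv[of j] by (simp add: algebra_simps)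
    then show ?thesis using th by simp
  qed
  define r where "r = Min ((\<lambda>j. t (Suc j) / t j) ` {..k})"
  have tpos: "t j > 0" for j using pos[of j] by simp
  have r1: "r > 1" unfolding r_def using mono tpos by (subst Min_gr_iff) auto
  have rle: "r * t j \<le> t (Suc j)" if "j < p" for j
  proof -
    have "r \<le> t (Suc j) / t j" unfolding r_def using that by (intro Min_le) (auto simp: p_def)
    then show ?thesis using tpos[of j] by (simp add: field_simps)
  qed
  have hp: "h ^ m > 0" for m using h1 by simp
  show ?thesis
  proof
    show "1 < r" by fact
    show "x 0 = 1" by (simp add: x_def t0)
    show "r * x n \<le> x (Suc n)" for n
      using mult_left_mono[OF rle[of "n mod p"] less_imp_le[OF hp[of "n div p"]]]
      unfolding xSuc unfolding x_def by (simp add: p_def mult.left_commute)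
    show "x (Suc n) \<le> g * x n" for n
      using mult_left_mono[OF tle[of "n mod p"] less_imp_le[OF hp[of "n div p"]]]
      unfolding xSuc unfolding x_def by (simp add: mult.left_commute)
    show "x (Suc n) = g * x n" if "p dvd n" for n
      using that unfolding xSuc unfolding x_def by (simp add: t1 t0 dvd_eq_mod_eq_0)
    have lam': "lam * (1 + \<theta>) = 1" using th lam by (simp add: field_simps)
    show "lam * (x (Suc n) - x (n - 1)) = x (Suc n) - x n" if "\<not> p dvd n" for n
    proof -
      have "n mod p \<noteq> 0" using that by (simp only: mod_eq_0_iff_dvd not_False_eq_True)
      then obtain j where j: "n mod p = Suc j" by (cases "n mod p") auto
      obtain m where m: "n = Suc m" using j by (cases n) auto
      have mj: "m mod p = j" "m div p = n div p" using j unfolding m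
        by (auto simp: mod_Suc div_Suc split: if_splits)
      have "x (Suc n) - x m = (1 + \<theta>) * (x (Suc n) - x n)"
      proof -
        have "t (Suc (Suc j)) - t j = (1 + \<theta>) * (t (Suc (Suc j)) - t (Suc j))"
          using A[of j] by (simp add: algebra_simps)
        then show ?thesis unfolding xSuc unfolding x_def j mj right_diff_distrib[symmetric] by simp
      qed
      then show ?thesis using lam' by (simp add: m flip: mult.assoc)
    qed
    show "lam * (x (Suc n) - x (n - p - 1)) = x (Suc n) - x n" if d: "p dvd n" "2 * p \<le> n" for n
    proof -
      obtain m where m0: "n = p * m" using d(1) by (rule dvdE)
      have "p * 2 \<le> p * m" using d(2) unfolding m0 by (simp only: mult.commute)
      then have "2 \<le> m" by (rule mult_left_le_imp_le) (simp add: p_def)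
      then obtain m' where m: "m = Suc (Suc m')" by (metis add_2_eq_Suc le_Suc_ex)
      have "k < p" by (simp add: p_def)
      have e: "n - p - 1 = p * m' + k" unfolding m0 m by (simp add: p_def)
      have "x (n - p - 1) = h ^ m' * t k" unfolding e x_def using \<open>k < p\<close> by simp
      also have "\<dots> = h ^ m * (1 + \<theta> - \<theta> * g)" by (subst B2) (simp add: m)
      finally have xo: "x (n - p - 1) = h ^ m * (1 + \<theta> - \<theta> * g)" .
      have xn: "x n = h ^ m" "x (Suc n) = h ^ m * g"
        unfolding xSuc unfolding x_def m0 using \<open>k < p\<close> by (simp_all add: t0 t1)
      have "x (Suc n) - x (n - p - 1) = (1 + \<theta>) * (x (Suc n) - x n)"
        unfolding xo xn by (simp add: algebra_simps)
      then show ?thesis using lam' by (simp flip: mult.assoc)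
    qed
  qed
qed

section \<open>Uniqueness and exponents of strictly minimal sequences\<close>

lemma max_coordinate_le_norm: "(MAX j\<in>UNIV. \<bar>v $ j\<bar>) \<le> norm v" for v :: "real ^ 3"
  by (subst Max_le_iff) (auto intro: component_le_norm_cart)

text \<open>The exponents use the maximum norm, the best approximations the Euclidean norm. The
  factor 3 only shifts logarithms by a constant.\<close>

lemma norm_le_max_coordinate: "norm v \<le> 3 * (MAX j\<in>UNIV. \<bar>v $ j\<bar>)" for v :: "real ^ 3"
proof -
  have "\<bar>v $ i\<bar> \<le> (MAX j\<in>UNIV. \<bar>v $ j\<bar>)" for i by (rule Max_ge) auto
  from this[of 1] this[of 2] this[of 3] show ?thesis
    using norm_le_l1_cart[of v] unfolding sum_3 by linarith
qed

lemma strict_mono_range_unique: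
  fixes f g :: "nat \<Rightarrow> int"
  assumes "strict_mono f" "strict_mono g" "range f = range g"
  shows "f n = g n"
proof (induction n rule: less_induct)
  case (less n)
  obtain m where m: "f n = g m" using assms(3) by (metis rangeI image_iff)
  obtain l where l: "g n = f l" using assms(3) by (metis rangeI image_iff)
  have "n \<le> m" using less[of m] m assms(1) by (metis leI nat_neq_iff strict_mono_eq)
  moreover have "n \<le> l" using less[of l] l assms(2) by (metis leI nat_neq_iff strict_mono_eq)
  ultimately show ?case
    using m l assms(1,2) by (metis antisym strict_mono_less_eq)
qed

text \<open>\<open>best_approx\<close> is a choice, so it can be computed only where the sequence is
  unique. Strictness in \<open>minimal\<close>, also against other numerators over the same
  denominator, rules out ties and thereby determines \<open>best_approx\<close>.\<close>

locale strictly_minimal_sequence =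
  fixes \<alpha> :: "real ^ 3" and b :: "nat \<Rightarrow> int \<times> (int ^ 3)" and \<xi> :: "nat \<Rightarrow> real"
  defines "\<xi> n \<equiv> norm (err \<alpha> (fst (b n)) (snd (b n)))"
  assumes first: "fst (b 0) = 1"
    and increasing: "fst (b n) < fst (b (Suc n))"
    and decreasing: "\<xi> (Suc n) < \<xi> n"
    and minimal: "1 \<le> q \<Longrightarrow> q < fst (b (Suc n)) \<Longrightarrow> (q, a) \<noteq> b n \<Longrightarrow> \<xi> n < norm (err \<alpha> q a)"
begin

abbreviation Q :: "nat \<Rightarrow> int" where "Q n \<equiv> fst (b n)"

lemma Q_mono: "strict_mono Q"
  using increasing by (simp add: strict_mono_Suc_iff)

lemma Q_ge: "int n + 1 \<le> Q n"
proof (induction n)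
  case (Suc n)
  then show ?case using increasing[of n] by simp
qed (simp add: first)

lemma Q_ge_1: "1 \<le> Q n"
  using Q_ge[of n] by simp

lemma xi_less: "m < n \<Longrightarrow> \<xi> n < \<xi> m"
  using lift_Suc_mono_less[of "\<lambda>n. - \<xi> n"] decreasing by force

lemma xi_pos: "0 < \<xi> n"
  using decreasing[of n] unfolding \<xi>_def by (rule order.strict_trans1[rotated]) simp

lemma interval_exists:
  assumes "1 \<le> q"
  obtains n where "Q n \<le> q" "q < Q (Suc n)"
proof -
  define n where "n = (LEAST n. q < Q (Suc n))"
  have "q < Q (Suc (nat q))" using Q_ge[of "Suc (nat q)"] assms by simp
  then have 1: "q < Q (Suc n)" unfolding n_def by (rule LeastI)
  moreover have "Q n \<le> q"
  proof (cases n)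
    case 0
    then show ?thesis using first assms by simp
  next
    case (Suc m)
    then have "\<not> q < Q (Suc m)" using not_less_Least[of m "\<lambda>n. q < Q (Suc n)"] n_def by auto
    then show ?thesis using Suc by simp
  qed
  ultimately show ?thesis using that by blast
qed

lemma minimal_le:
  assumes "1 \<le> q" "q < Q (Suc n)"
  shows "\<xi> n \<le> norm (err \<alpha> q a)"
  using minimal[OF assms, of a] by (cases "(q, a) = b n") (auto simp: \<xi>_def dest: sym)

text \<open>A common denominator of the coordinates would have error 0, whereas all denominators
  below \<open>Q (Suc n)\<close> have errors at least \<open>\<xi> n > 0\<close>.\<close>

lemma not_rational: "\<not> rational_point \<alpha>"
proof
  assume r: "rational_point \<alpha>"
  have "\<exists>a d. (0::int) < d \<and> \<alpha> $ j = of_int a / of_int d" for j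
    using r unfolding rational_point_def by (metis Rats_cases')
  then obtain a d where d: "\<And>j. 0 < (d j :: int)" and a: "\<And>j. \<alpha> $ j = of_int (a j) / of_int (d j)"
    by metis
  define D where "D = (\<Prod>j\<in>UNIV. d j)"
  have "0 < D" unfolding D_def using d by (simp add: prod_pos)
  then have D: "1 \<le> D" by simp
  have "err \<alpha> D (\<chi> j. a j * (\<Prod>i\<in>UNIV - {j}. d i)) = 0"
  proof -
    have "D = d j * (\<Prod>i\<in>UNIV - {j}. d i)" for j unfolding D_def by (simp add: prod.remove)
    then have D_eq: "real_of_int D = of_int (d j) * of_int (\<Prod>i\<in>UNIV - {j}. d i)" for j
      by (metis of_int_mult)
    have "of_int D * \<alpha> $ j = of_int (a j * (\<Prod>i\<in>UNIV - {j}. d i))" for j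
      using d[of j] unfolding a D_eq[of j] by simp
    then show ?thesis by (simp add: err_def vec_eq_iff)
  qed
  moreover obtain n where "D < Q (Suc n)" using interval_exists[OF D] .
  ultimately show False using minimal_le[OF D] xi_pos by (metis norm_zero not_le)
qed

text \<open>For completeness: a minimal point with denominator strictly between \<open>Q n\<close>
  and \<open>Q (Suc n)\<close> would have to improve on \<open>\<xi> n\<close>, which
  \<open>minimal\<close> forbids.\<close>

lemma best_approximations_self: "best_approximations \<alpha> b"
proof -
  have min: "\<xi> n \<le> norm (err \<alpha> q' a')" if "1 \<le> q'" "q' \<le> Q n" for n q' a'
    using minimal_le that increasing[of n] by simp
  have complete: "p \<in> range Q" if p: "1 \<le> p"
    and p2: "\<forall>q' a'. 1 \<le> q' \<and> q' < p \<longrightarrow> norm (err \<alpha> p c) < norm (err \<alpha> q' a')" for p c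
  proof -
    obtain n where n: "Q n \<le> p" "p < Q (Suc n)" using interval_exists[OF p] .
    have "\<not> Q n < p"
    proof
      assume "Q n < p"
      then have "norm (err \<alpha> p c) < \<xi> n" using p2 Q_ge_1[of n] unfolding \<xi>_def by blast
      then show False using minimal_le[OF p n(2), of c] by simp
    qed
    then show ?thesis using n by auto
  qed
  show ?thesis unfolding best_approximations_def Let_def
    using Q_ge_1[of 0] Q_mono xi_less min complete unfolding \<xi>_def by (intro conjI allI impI) blast+
qed

text \<open>A member of \<open>z\<close> with denominator in \<open>[Q n, Q (Suc n))\<close> has
  error at most \<open>\<xi> n\<close>, so strictness forces it to be \<open>b n\<close>.
  Conversely, completeness of \<open>z\<close> supplies every \<open>Q n\<close>, and increasing
  sequences with equal ranges agree.\<close>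

lemma best_approximations_unique:
  assumes z: "best_approximations \<alpha> z"
  shows "z = b"
proof -
  have z0: "1 \<le> fst (z 0)" and zm: "strict_mono (\<lambda>n. fst (z n))"
    and zmin: "\<And>n q' a'. 1 \<le> q' \<Longrightarrow> q' \<le> fst (z n) \<Longrightarrow>
      norm (err \<alpha> (fst (z n)) (snd (z n))) \<le> norm (err \<alpha> q' a')"
    and zc: "\<And>p c. 1 \<le> p \<Longrightarrow> (\<forall>a'. norm (err \<alpha> p c) \<le> norm (err \<alpha> p a')) \<Longrightarrow>
      (\<forall>q' a'. 1 \<le> q' \<and> q' < p \<longrightarrow> norm (err \<alpha> p c) < norm (err \<alpha> q' a')) \<Longrightarrow> p \<in> range (\<lambda>n. fst (z n))"
  proof -
    note c = z[unfolded best_approximations_def Let_def]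
    show "1 \<le> fst (z 0)" by (rule c[THEN conjunct1])
    note c = c[THEN conjunct2]
    show "strict_mono (\<lambda>n. fst (z n))" by (rule c[THEN conjunct1])
    note c = c[THEN conjunct2, THEN conjunct2]
    show "norm (err \<alpha> (fst (z n)) (snd (z n))) \<le> norm (err \<alpha> q' a')" if "1 \<le> q'" "q' \<le> fst (z n)" for n q' a'
      using c[THEN conjunct1] that by simp
    show "p \<in> range (\<lambda>n. fst (z n))" if "1 \<le> p" "\<forall>a'. norm (err \<alpha> p c) \<le> norm (err \<alpha> p a')"
      "\<forall>q' a'. 1 \<le> q' \<and> q' < p \<longrightarrow> norm (err \<alpha> p c) < norm (err \<alpha> q' a')" for p c
      by (rule c[THEN conjunct2, THEN spec, THEN spec[of _ c], THEN mp]) (intro conjI that)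
  qed
  have zb: "\<exists>n. z m = b n" for m
  proof -
    have m1: "1 \<le> fst (z m)" using z0 strict_mono_leD[OF zm, of 0 m] by simp
    obtain n where n: "Q n \<le> fst (z m)" "fst (z m) < Q (Suc n)" using interval_exists[OF m1] .
    have "norm (err \<alpha> (fst (z m)) (snd (z m))) \<le> \<xi> n"
      unfolding \<xi>_def using zmin[OF Q_ge_1 n(1)] .
    then have "(fst (z m), snd (z m)) = b n" using minimal[OF m1 n(2), of "snd (z m)"] by linarith
    then show ?thesis by auto
  qed
  have bz: "Q n \<in> range (\<lambda>n. fst (z n))" for n
  proof (rule zc[of _ "snd (b n)"])
    show "1 \<le> Q n" by (rule Q_ge_1)
    show "\<forall>a'. norm (err \<alpha> (Q n) (snd (b n))) \<le> norm (err \<alpha> (Q n) a')"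
      using minimal_le[OF Q_ge_1 increasing] unfolding \<xi>_def by blast
    show "\<forall>q' a'. 1 \<le> q' \<and> q' < Q n \<longrightarrow> norm (err \<alpha> (Q n) (snd (b n))) < norm (err \<alpha> q' a')"
    proof (intro allI impI)
      fix q' a' assume q': "1 \<le> q' \<and> q' < Q n"
      then obtain m where m: "n = Suc m" using first by (cases n) auto
      have "\<xi> n < \<xi> m" using decreasing m by simp
      also have "\<xi> m \<le> norm (err \<alpha> q' a')" using minimal_le q' m by simp
      finally show "norm (err \<alpha> (Q n) (snd (b n))) < norm (err \<alpha> q' a')" unfolding \<xi>_def .
    qed
  qed
  have "range (\<lambda>n. fst (z n)) = range Q"
    using zb bz by (auto simp: image_iff) metis
  then have eq: "fst (z n) = Q n" for n using strict_mono_range_unique[OF zm Q_mono] by blast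
  show ?thesis
  proof
    fix n
    obtain m where "z n = b m" using zb by blast
    with eq[of n] have "Q m = Q n" by simp
    then have "m = n" using strict_mono_eq[OF Q_mono, of m n] by simp
    then show "z n = b n" using \<open>z n = b m\<close> by simp
  qed
qed

lemma best_approx_eq: "best_approx \<alpha> = b"
  unfolding best_approx_def using best_approximations_self best_approximations_unique by (rule some_equality)

section \<open>Exponents read off from a strictly minimal sequence\<close>

lemma xi_le_if_solvable:
  fixes X :: real
  assumes "approx_solvable \<alpha> \<gamma> X" "X < Q (Suc n)"
  shows "\<xi> n \<le> 3 * X powr (- \<gamma>)"
proof -
  obtain q a where q: "1 \<le> q" "of_int q \<le> X" and a: "(MAX j\<in>UNIV. \<bar>err \<alpha> q a $ j\<bar>) \<le> X powr (- \<gamma>)"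
    using assms(1) unfolding approx_solvable_def by blast
  have "\<xi> n \<le> norm (err \<alpha> q a)" using minimal_le[OF q(1), of n a] q(2) assms(2) by linarith
  also have "\<dots> \<le> 3 * X powr (- \<gamma>)" using norm_le_max_coordinate[of "err \<alpha> q a"] a by linarith
  finally show ?thesis .
qed

lemma solvable_if_xi_le:
  fixes X :: real
  assumes "\<xi> n \<le> X powr (- \<gamma>)" "Q n \<le> X"
  shows "approx_solvable \<alpha> \<gamma> X"
  unfolding approx_solvable_def
  using assms Q_ge_1[of n] max_coordinate_le_norm[of "err \<alpha> (Q n) (snd (b n))"] unfolding \<xi>_def
  by (intro exI[of _ "Q n"] exI[of _ "snd (b n)"]) linarith

lemma ln_Q_at_top: "filterlim (\<lambda>n. ln (Q n)) at_top sequentially"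
proof (rule filterlim_compose[OF ln_at_top])
  have "real n \<le> Q n" for n using Q_ge[of n] by linarith
  then show "filterlim (\<lambda>n. real_of_int (Q n)) at_top sequentially"
    by (intro filterlim_at_top_mono[OF filterlim_real_sequentially] always_eventually) auto
qed

lemma interval_exists_real:
  fixes X :: real
  assumes "1 \<le> X" "Q N \<le> X"
  obtains n where "N \<le> n" "Q n \<le> X" "X < Q (Suc n)"
proof -
  obtain n where n: "Q n \<le> \<lfloor>X\<rfloor>" "\<lfloor>X\<rfloor> < Q (Suc n)" using interval_exists[of "\<lfloor>X\<rfloor>"] assms by auto
  have "real_of_int (Q N) < Q (Suc n)" using n assms by linarith
  then have "N < Suc n" using strict_mono_less[OF Q_mono, of N "Suc n"] by simp
  then have "N \<le> n" by simp
  then show ?thesis using that n by (simp add: le_floor_iff floor_less_iff)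
qed

lemma ereal_le_SUP_dense:
  assumes "\<And>\<gamma>. 0 \<le> \<gamma> \<Longrightarrow> \<gamma> < \<mu> \<Longrightarrow> \<gamma> \<in> A" "0 < \<mu>"
  shows "ereal \<mu> \<le> (SUP \<gamma>\<in>A. ereal \<gamma>)"
proof (rule dense_le_bounded[of 0])
  fix y assume y: "0 < y" "y < ereal \<mu>"
  then obtain \<gamma> where \<gamma>: "y = ereal \<gamma>" by (cases y) auto
  then show "y \<le> (SUP \<gamma>\<in>A. ereal \<gamma>)" using assms(1)[of \<gamma>] y by (auto intro: SUP_upper)
qed (use assms in simp)

text \<open>For \<open>Q n \<le> X < Q (Suc n)\<close> the best error is \<open>\<xi> n\<close>, and
  the hardest demand on it comes from \<open>X\<close> near \<open>Q (Suc n)\<close>.\<close>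

lemma omega_hat_eq:
  assumes lim: "(\<lambda>n. - ln (\<xi> n) / ln (Q (Suc n))) \<longlonglongrightarrow> \<mu>" and "0 < \<mu>"
  shows "omega_hat \<alpha> = ereal \<mu>"
  unfolding omega_hat_def
proof (rule antisym)
  have lnQ: "0 < ln (Q (Suc n))" for n using Q_ge[of "Suc n"] by simp
  show "ereal \<mu> \<le> (SUP \<gamma>\<in>{\<gamma>. \<forall>\<^sub>F X in at_top. approx_solvable \<alpha> \<gamma> X}. ereal \<gamma>)"
  proof (rule ereal_le_SUP_dense[OF _ \<open>0 < \<mu>\<close>], clarify)
    fix \<gamma> :: real assume \<gamma>: "0 \<le> \<gamma>" "\<gamma> < \<mu>"
    obtain N where N: "\<And>n. N \<le> n \<Longrightarrow> \<gamma> < - ln (\<xi> n) / ln (Q (Suc n))"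
      using order_tendstoD(1)[OF lim \<gamma>(2)] unfolding eventually_sequentially by blast
    have "approx_solvable \<alpha> \<gamma> X" if X: "Q N \<le> X" for X :: real
    proof -
      have X1: "1 \<le> X" using X Q_ge_1[of N] by linarith
      obtain n where n: "N \<le> n" "Q n \<le> X" "X < Q (Suc n)" using interval_exists_real[OF X1 X] .
      have "ln (\<xi> n) \<le> - \<gamma> * ln (Q (Suc n))"
        using N[OF n(1)] lnQ[of n] by (simp add: field_simps)
      also have "\<dots> \<le> - \<gamma> * ln X" using n(3) X1 \<gamma>(1) by (simp add: mult_left_mono)
      finally have "\<xi> n \<le> exp (- \<gamma> * ln X)" using xi_pos[of n] by (metis exp_le_cancel_iff exp_ln)
      then show ?thesis using n X1 by (intro solvable_if_xi_le[of n]) (auto simp: powr_def)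
    qed
    then show "\<forall>\<^sub>F X in at_top. approx_solvable \<alpha> \<gamma> X" by (rule eventually_at_top_linorderI)
  qed
  show "(SUP \<gamma>\<in>{\<gamma>. \<forall>\<^sub>F X in at_top. approx_solvable \<alpha> \<gamma> X}. ereal \<gamma>) \<le> ereal \<mu>"
  proof (rule SUP_least, clarify, rule ccontr)
    fix \<gamma> :: real assume ev: "\<forall>\<^sub>F X in at_top. approx_solvable \<alpha> \<gamma> X" and "\<not> ereal \<gamma> \<le> ereal \<mu>"
    then have "\<mu> < \<gamma>" by simp
    then obtain \<gamma>' where \<gamma>': "\<mu> < \<gamma>'" "\<gamma>' < \<gamma>" using dense by blast
    have "\<forall>\<^sub>F n in sequentially. - ln (\<xi> n) / ln (Q (Suc n)) < \<gamma>'"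
      using order_tendstoD(2)[OF lim \<gamma>'(1)] .
    moreover have "filterlim (\<lambda>n. real_of_int (Q (Suc n)) - 1) at_top sequentially"
    proof -
      have "real n \<le> real_of_int (Q (Suc n)) - 1" for n using Q_ge[of "Suc n"] by linarith
      then show ?thesis
        by (intro filterlim_at_top_mono[OF filterlim_real_sequentially] always_eventually) auto
    qed
    then have "\<forall>\<^sub>F n in sequentially. approx_solvable \<alpha> \<gamma> (real_of_int (Q (Suc n)) - 1)"
      using ev by (simp add: filterlim_iff)
    \<comment> \<open>At \<open>X = Q (Suc n) - 1\<close> the change of norm costs a factor 3 and
      \<open>Q (Suc n) \<le> 2 * X\<close> costs a factor \<open>2 powr \<gamma>\<close>. Beyond
      this threshold the gap between \<open>\<gamma>'\<close> and \<open>\<gamma>\<close> pays for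
      both.\<close>
    moreover have "\<forall>\<^sub>F n in sequentially. (ln 3 + \<gamma> * ln 2) / (\<gamma> - \<gamma>') < ln (Q (Suc n))"
      using ln_Q_at_top by (subst eventually_sequentially_Suc) (simp add: filterlim_at_top_dense)
    moreover have "\<forall>\<^sub>F n in sequentially. 0 < n" by (rule eventually_gt_at_top)
    ultimately have "\<forall>\<^sub>F n in sequentially. False"
    proof eventually_elim
      case (elim n)
      define X where "X = real_of_int (Q (Suc n)) - 1"
      have "2 \<le> real_of_int (Q (Suc n))" using Q_ge[of "Suc n"] by simp
      then have X: "1 \<le> X" "real_of_int (Q (Suc n)) \<le> 2 * X" by (simp_all add: X_def)
      have "\<xi> n \<le> 3 * X powr (- \<gamma>)" using elim(2) unfolding X_def by (rule xi_le_if_solvable) simp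
      then have "ln (\<xi> n) \<le> ln (3 * X powr (- \<gamma>))" using xi_pos[of n] X by (subst ln_le_cancel_iff) auto
      also have "\<dots> = ln 3 - \<gamma> * ln X" using X by (simp add: ln_mult ln_powr)
      finally have 1: "\<gamma> * ln X \<le> ln 3 - ln (\<xi> n)" by simp
      have "ln (Q (Suc n)) \<le> ln (2 * X)" using X Q_ge_1[of "Suc n"] by (subst ln_le_cancel_iff) auto
      also have "\<dots> = ln 2 + ln X" using X by (simp add: ln_mult)
      finally have "\<gamma> * ln (Q (Suc n)) \<le> \<gamma> * (ln 2 + ln X)"
        using \<gamma>' \<open>0 < \<mu>\<close> by (intro mult_left_mono) auto
      moreover have "- ln (\<xi> n) < \<gamma>' * ln (Q (Suc n))"
        using elim(1) lnQ[of n] by (simp add: field_simps)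
      moreover have "ln 3 + \<gamma> * ln 2 < (\<gamma> - \<gamma>') * ln (Q (Suc n))"
        using elim(3) \<gamma>' by (simp add: field_simps)
      ultimately show False using 1 by (simp add: algebra_simps)
    qed
    then show False by simp
  qed
qed

text \<open>The most favourable \<open>X\<close> in \<open>[Q n, Q (Suc n))\<close> is the left end.
  The hypotheses say that \<open>\<mu>\<close> is the upper limit of
  \<open>- ln (\<xi> n) / ln (Q n)\<close>.\<close>

lemma omega_eq:
  assumes upper: "\<And>\<gamma>. \<mu> < \<gamma> \<Longrightarrow> \<forall>\<^sub>F n in sequentially. - ln (\<xi> n) < \<gamma> * ln (Q n)"
    and lower: "\<And>\<gamma>. \<gamma> < \<mu> \<Longrightarrow> \<exists>\<^sub>F n in sequentially. \<gamma> * ln (Q n) < - ln (\<xi> n)"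
    and "0 < \<mu>"
  shows "omega \<alpha> = ereal \<mu>"
  unfolding omega_def
proof (rule antisym)
  show "ereal \<mu> \<le> (SUP \<gamma>\<in>{\<gamma>. \<exists>\<^sub>F X in at_top. approx_solvable \<alpha> \<gamma> X}. ereal \<gamma>)"
  proof (rule ereal_le_SUP_dense[OF _ \<open>0 < \<mu>\<close>], clarify)
    fix \<gamma> :: real assume \<gamma>: "\<gamma> < \<mu>"
    show "\<exists>\<^sub>F X in at_top. approx_solvable \<alpha> \<gamma> X"
      unfolding frequently_def eventually_at_top_linorder
    proof clarify
      fix B assume B: "\<forall>X\<ge>B. \<not> approx_solvable \<alpha> \<gamma> X"
      have "\<forall>\<^sub>F n in sequentially. nat \<lceil>B\<rceil> \<le> n" by (rule eventually_ge_at_top)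
      then obtain n where n: "nat \<lceil>B\<rceil> \<le> n" "\<gamma> * ln (Q n) < - ln (\<xi> n)"
        using frequently_ex[OF frequently_eventually_conj[OF lower[OF \<gamma>]]] by blast
      have "B \<le> Q n" using n(1) Q_ge[of n] by linarith
      moreover have "\<xi> n \<le> exp (- \<gamma> * ln (Q n))"
      proof -
        have "ln (\<xi> n) \<le> - \<gamma> * ln (Q n)" using n(2) by linarith
        then have "exp (ln (\<xi> n)) \<le> exp (- \<gamma> * ln (Q n))" by (simp only: exp_le_cancel_iff)
        then show ?thesis using xi_pos[of n] by simp
      qed
      then have "approx_solvable \<alpha> \<gamma> (Q n)" using Q_ge_1[of n]
        by (intro solvable_if_xi_le[of n]) (auto simp: powr_def)
      ultimately show False using B by blast
    qed
  qed
  show "(SUP \<gamma>\<in>{\<gamma>. \<exists>\<^sub>F X in at_top. approx_solvable \<alpha> \<gamma> X}. ereal \<gamma>) \<le> ereal \<mu>"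
  proof (rule SUP_least, clarify, rule ccontr)
    fix \<gamma> :: real assume fr: "\<exists>\<^sub>F X in at_top. approx_solvable \<alpha> \<gamma> X" and "\<not> ereal \<gamma> \<le> ereal \<mu>"
    then have "\<mu> < \<gamma>" by simp
    then obtain \<gamma>' where \<gamma>': "\<mu> < \<gamma>'" "\<gamma>' < \<gamma>" using dense by blast
    have "\<forall>\<^sub>F n in sequentially. ln 3 / (\<gamma> - \<gamma>') < ln (Q n)"
      using ln_Q_at_top by (simp add: filterlim_at_top_dense)
    with upper[OF \<gamma>'(1)] obtain N where
      N: "\<And>n. N \<le> n \<Longrightarrow> - ln (\<xi> n) < \<gamma>' * ln (Q n)" "\<And>n. N \<le> n \<Longrightarrow> ln 3 / (\<gamma> - \<gamma>') < ln (Q n)"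
      unfolding eventually_sequentially by (metis nat_le_linear order_trans)
    have "\<not> approx_solvable \<alpha> \<gamma> X" if X: "Q N \<le> X" for X :: real
    proof
      assume s: "approx_solvable \<alpha> \<gamma> X"
      have X1: "1 \<le> X" using X Q_ge_1[of N] by linarith
      obtain n where n: "N \<le> n" "Q n \<le> X" "X < Q (Suc n)" using interval_exists_real[OF X1 X] .
      have "\<xi> n \<le> 3 * X powr (- \<gamma>)" using s n(3) by (rule xi_le_if_solvable)
      then have "ln (\<xi> n) \<le> ln (3 * X powr (- \<gamma>))" using xi_pos[of n] X1 by (subst ln_le_cancel_iff) auto
      also have "\<dots> = ln 3 - \<gamma> * ln X" using X1 by (simp add: ln_mult ln_powr)
      finally have "\<gamma> * ln X \<le> ln 3 - ln (\<xi> n)" by simp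
      moreover have "\<gamma> * ln (Q n) \<le> \<gamma> * ln X"
        using n Q_ge_1[of n] \<gamma>' \<open>0 < \<mu>\<close> by (intro mult_left_mono) auto
      moreover have "ln 3 < (\<gamma> - \<gamma>') * ln (Q n)" using N(2)[OF n(1)] \<gamma>' by (simp add: field_simps)
      ultimately show False using N(1)[OF n(1)] by (simp add: algebra_simps)
    qed
    then have "\<forall>\<^sub>F X in at_top. \<not> approx_solvable \<alpha> \<gamma> X" by (rule eventually_at_top_linorderI)
    then show False using fr by (simp add: frequently_def)
  qed
qed

end

section \<open>Lattice vectors with obtuse errors\<close>

text \<open>The vectors form a triangular array with unit diagonal, hence a lattice basis. The entry
  -2 makes the last two obtuse as well: every pair has inner product -1.\<close>

definition shape :: "nat \<Rightarrow> int ^ 3" where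
  "shape i = (if i = 0 then vector [1, 0, 0] else if i = 1 then vector [-1, 1, 0] else vector [-1, -2, 1])"

definition real_shape :: "nat \<Rightarrow> real ^ 3" where
  "real_shape i = (\<chi> j. of_int (shape i $ j))"

lemma real_shape_inner:
  assumes "i < 3" "j < 3" "i \<noteq> j"
  shows "real_shape i \<bullet> real_shape j \<le> -1"
proof -
  have "i \<in> {0, 1, 2}" "j \<in> {0, 1, 2}" using assms by auto
  then show ?thesis using assms(3)
    by (auto simp: real_shape_def shape_def inner_vec_def sum_3)
qed

lemma real_shape_norm: "1 \<le> norm (real_shape i)" "norm (real_shape i) \<le> 3"
  unfolding norm_eq_sqrt_inner
  by (auto simp: real_shape_def shape_def inner_vec_def sum_3 intro: real_le_lsqrt)

text \<open>Back substitution gives \<open>c = v $ 3\<close>, \<open>b = v $ 2 + 2 * v $ 3\<close>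
  and \<open>a = v $ 1 + v $ 2 + 3 * v $ 3\<close>; 5 is the sum of the coefficients in the last
  one.\<close>

lemma real_shape_coords_aux:
  fixes a b c :: real
  assumes "v = a *\<^sub>R real_shape 0 + b *\<^sub>R real_shape 1 + c *\<^sub>R real_shape 2"
  shows "\<bar>a\<bar> \<le> 5 * norm v" "\<bar>b\<bar> \<le> 5 * norm v" "\<bar>c\<bar> \<le> 5 * norm v"
proof -
  have c: "v $ 1 = a - b - c" "v $ 2 = b - 2 * c" "v $ 3 = c"
    by (simp_all add: assms real_shape_def shape_def)
  have "\<bar>v $ i\<bar> \<le> norm v" for i by (rule component_le_norm_cart)
  from this[of 1] this[of 2] this[of 3]
  show "\<bar>a\<bar> \<le> 5 * norm v" "\<bar>b\<bar> \<le> 5 * norm v" "\<bar>c\<bar> \<le> 5 * norm v" unfolding c by linarith+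
qed

lemma real_shape_coords:
  fixes a b c :: real
  assumes "{i, j, k} = {0, 1, 2}"
  shows "max \<bar>a\<bar> (max \<bar>b\<bar> \<bar>c\<bar>) \<le> 5 * norm (a *\<^sub>R real_shape i + b *\<^sub>R real_shape j + c *\<^sub>R real_shape k)"
    (is "_ \<le> 5 * norm ?v")
proof -
  have "i \<in> {0, 1, 2}" "j \<in> {0, 1, 2}" "k \<in> {0, 1, 2}" using assms by blast+
  moreover have "card {i, j, k} = 3" unfolding assms by simp
  then have "i \<noteq> j" "j \<noteq> k" "i \<noteq> k" by (auto simp: card_insert_if split: if_splits)
  ultimately consider "i = 0" "j = 1" "k = 2" | "i = 0" "j = 2" "k = 1" | "i = 1" "j = 0" "k = 2"
    | "i = 1" "j = 2" "k = 0" | "i = 2" "j = 0" "k = 1" | "i = 2" "j = 1" "k = 0"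
    by (elim insertE emptyE) simp_all
  then have "\<bar>a\<bar> \<le> 5 * norm ?v \<and> \<bar>b\<bar> \<le> 5 * norm ?v \<and> \<bar>c\<bar> \<le> 5 * norm ?v"
  proof cases
    case 1 then show ?thesis using real_shape_coords_aux[of ?v a b c] by simp
  next
    case 2 then show ?thesis using real_shape_coords_aux[of ?v a c b] by (simp add: add_ac)
  next
    case 3 then show ?thesis using real_shape_coords_aux[of ?v b a c] by (simp add: add_ac)
  next
    case 4 then show ?thesis using real_shape_coords_aux[of ?v c a b] by (simp add: add_ac)
  next
    case 5 then show ?thesis using real_shape_coords_aux[of ?v b c a] by (simp add: add_ac)
  next
    case 6 then show ?thesis using real_shape_coords_aux[of ?v c b a] by (simp add: add_ac)
  qed
  then show ?thesis by simp
qed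

text \<open>\<open>isB\<close> marks the steps with letter B, and \<open>Y n\<close> prescribes
  minus the logarithm of the error with index \<open>n\<close>. A gap that grows with
  \<open>n\<close> makes each error small against all earlier ones at a geometrically summable
  rate.\<close>

locale regular_system =
  fixes isB :: "nat \<Rightarrow> bool" and Y :: "nat \<Rightarrow> real"
  assumes Y_init: "n < 3 \<Longrightarrow> Y n = 0"
    and Y_gap: "2 \<le> n \<Longrightarrow> Y n + 10 + n \<le> Y (Suc n)"
begin

text \<open>At stage \<open>n\<close> the lattice basis consists of the vectors with indices \<open>n\<close>, \<open>n - 1\<close>,
  \<open>n - 2\<close> and \<open>w n\<close>. All indices below 3 belong to the starting vectors.\<close>

primrec w :: "nat \<Rightarrow> nat" where
  "w 0 = 0"
| "w (Suc n) = (if 3 \<le> n \<and> isB n then n - 2 else w n)"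

definition old :: "nat \<Rightarrow> nat" where
  "old n = (if isB n then w n else n - 2)"

lemma w_bound: "3 \<le> n \<Longrightarrow> w n + 2 < n"
proof (induction n rule: dec_induct)
  case base
  then show ?case by (simp add: eval_nat_numeral)
qed auto

lemma old_less: "3 \<le> n \<Longrightarrow> old n < n"
  using w_bound[of n] by (auto simp: old_def)

lemma old_pred_less: "\<not> n < 3 \<Longrightarrow> n \<noteq> 3 \<Longrightarrow> old (n - Suc 0) < n"
  using old_less[of "n - 1"] by (cases "3 \<le> n - 1") auto

text \<open>The error of the \<open>n\<close>-th vector is close to \<open>W n *\<^sub>R real_shape (cls n)\<close>. Rounding against the
  actual value of \<open>W (old n)\<close> keeps \<open>W n\<close> within a factor 2 of \<open>exp (- Y n)\<close>, without
  accumulation of rounding errors.\<close>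

function cls :: "nat \<Rightarrow> nat" where
  "cls n = (if n < 3 then n else cls (old n))"
  by auto
termination by (relation "Wellfounded.measure id") (auto simp: old_less)

function W :: "nat \<Rightarrow> real" where
  "W n = (if n < 3 then 1 else W (old n) / of_int \<lceil>exp (Y n) * W (old n)\<rceil>)"
  by auto
termination by (relation "Wellfounded.measure id") (auto simp: old_less)

definition c :: "nat \<Rightarrow> int" where
  "c n = \<lceil>exp (Y n) * W (old n)\<rceil>"

text \<open>The minus sign makes the errors of the first three vectors equal to the basis vectors,
  whatever the point (\<open>V_init\<close>). Index 3 carries \<open>(1, 0)\<close>, the first
  vector with positive denominator.\<close>

function Z :: "nat \<Rightarrow> int \<times> (int ^ 3)" where
  "Z n = (if n < 3 then (0, - shape n) else if n = 3 then (1, 0) else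
     (c (n - 1) * fst (Z (n - 1)) - fst (Z (old (n - 1))),
      c (n - 1) *s snd (Z (n - 1)) - snd (Z (old (n - 1)))))"
  by auto
termination
  by (relation "Wellfounded.measure id") (simp_all add: old_pred_less)

declare cls.simps [simp del] W.simps [simp del] Z.simps [simp del]

lemma Z_Suc:
  assumes "3 \<le> n"
  shows "fst (Z (Suc n)) = c n * fst (Z n) - fst (Z (old n))"
    "snd (Z (Suc n)) = c n *s snd (Z n) - snd (Z (old n))"
  using assms by (simp_all add: Z.simps[of "Suc n"])

lemma cls_init: "n < 3 \<Longrightarrow> cls n = n"
  by (simp add: cls.simps)

lemma cls_old: "3 \<le> n \<Longrightarrow> cls n = cls (old n)"
  by (simp add: cls.simps[of n])

text \<open>A step exchanges \<open>Z (old n)\<close> for \<open>Z n\<close>, which has the same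
  class, so all three classes stay present. The errors of the three older basis vectors thus have
  nearly independent directions.\<close>

lemma classes:
  assumes "3 \<le> n"
  shows "{cls (w n), cls (n - 2), cls (n - 1)} = {0, 1, 2}"
  using assms
proof (induction n rule: dec_induct)
  case base
  have "w 3 = 0" by (simp add: eval_nat_numeral)
  then show ?case by (auto simp: cls_init)
next
  case (step n)
  show ?case
  proof (cases "isB n")
    case True
    then have "w (Suc n) = n - 2" "cls n = cls (w n)" using step cls_old[of n] by (auto simp: old_def)
    then show ?thesis unfolding step.IH[symmetric] by auto
  next
    case False
    then have "w (Suc n) = w n" "cls n = cls (n - 2)" using step cls_old[of n] by (auto simp: old_def)
    then show ?thesis unfolding step.IH[symmetric] by auto
  qed
qed

text \<open>The candidates for \<open>old (Suc n)\<close> are \<open>w (Suc n)\<close> and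
  \<open>n - 1\<close>, whose classes differ from \<open>cls n\<close>. Consecutive errors will be
  obtuse for this reason.\<close>

lemma classes_Suc_neq:
  assumes "3 \<le> n"
  shows "cls (Suc n) < 3" "cls n < 3" "cls (Suc n) \<noteq> cls n"
proof -
  have o: "cls (Suc n) = cls (old (Suc n))" using assms by (simp add: cls_old)
  have s: "{cls (w (Suc n)), cls (n - 1), cls n} = {0, 1, 2}" using classes[of "Suc n"] assms by simp
  then have "cls (w (Suc n)) \<in> {0, 1, 2}" "cls (n - 1) \<in> {0, 1, 2}" "cls n \<in> {0, 1, 2}" by blast+
  moreover have "card {cls (w (Suc n)), cls (n - 1), cls n} = 3" unfolding s by simp
  then have "cls (w (Suc n)) \<noteq> cls n" "cls (n - 1) \<noteq> cls n"
    by (auto simp: card_insert_if split: if_splits)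
  ultimately have "cls (w (Suc n)) \<noteq> cls n" "cls (n - 1) \<noteq> cls n"
    "cls (w (Suc n)) < 3" "cls (n - 1) < 3" "cls n < 3" by auto
  then show "cls (Suc n) < 3" "cls n < 3" "cls (Suc n) \<noteq> cls n"
    using assms unfolding o old_def by auto
qed

section \<open>Sizes of errors, multipliers and denominators\<close>

lemma Y_mono: "i \<le> n \<Longrightarrow> Y i \<le> Y n"
proof (rule lift_Suc_mono_le)
  fix n show "Y n \<le> Y (Suc n)"
    using Y_gap[of n] Y_init[of n] Y_init[of "Suc n"] by (cases "2 \<le> n") auto
qed

lemma Y_gap_less:
  assumes "i < n" "3 \<le> n"
  shows "Y i + 9 + n \<le> Y n"
proof -
  obtain m where m: "n = Suc m" using assms by (cases n) auto
  show ?thesis using Y_gap[of m] Y_mono[of i m] assms unfolding m by simp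
qed

lemma ceiling_le_double: "1 \<le> t \<Longrightarrow> of_int \<lceil>t\<rceil> \<le> 2 * t" for t :: real
  by linarith

text \<open>With \<open>T = exp (Y n) * W (old n)\<close> the definition reads
  \<open>W n = exp (- Y n) * (T / \<lceil>T\<rceil>)\<close>. The gaps of \<open>Y\<close> give
  \<open>T \<ge> 1\<close>, which puts the last factor between 1/2 and 1.\<close>

lemma W_bounds: "exp (- Y n) / 2 \<le> W n" "W n \<le> exp (- Y n)"
proof (induction n rule: less_induct)
  case (less n)
  have "exp (- Y n) / 2 \<le> W n \<and> W n \<le> exp (- Y n)"
  proof (cases "n < 3")
    case True
    then show ?thesis by (simp add: W.simps Y_init)
  next
    case False
    define T where "T = exp (Y n) * W (old n)"
    have IH: "exp (- Y (old n)) / 2 \<le> W (old n)" using less(1)[OF old_less] False by simp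
    have "2 \<le> exp (Y n - Y (old n))"
      using Y_gap_less[OF old_less[of n]] False exp_ge_add_one_self[of "Y n - Y (old n)"] by linarith
    also have "\<dots> \<le> 2 * T" unfolding T_def exp_diff
      using mult_left_mono[OF IH, of "2 * exp (Y n)"] by (simp add: exp_minus field_simps)
    finally have T: "1 \<le> T" by simp
    have Wn: "W n = exp (- Y n) * (T / of_int \<lceil>T\<rceil>)"
      using False by (simp add: W.simps[of n] T_def exp_minus)
    have "T / of_int \<lceil>T\<rceil> \<le> 1" "1 / 2 \<le> T / of_int \<lceil>T\<rceil>"
      using T ceiling_le_double[OF T] le_of_int_ceiling[of T] by (auto simp: field_simps)
    then show ?thesis unfolding Wn using mult_left_mono[of _ _ "exp (- Y n)"] by fastforce
  qed
  then show "exp (- Y n) / 2 \<le> W n" "W n \<le> exp (- Y n)" by auto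
qed

lemma W_pos: "0 < W n"
  using W_bounds(1)[of n] by (rule less_le_trans[rotated]) simp

lemma W_ratio:
  assumes "i < n" "3 \<le> n"
  shows "W n \<le> W i / 2 ^ (8 + n)"
proof -
  have "(2::real) ^ (9 + n) \<le> exp 1 ^ (9 + n)"
    using exp_ge_add_one_self[of 1] by (intro power_mono) auto
  also have "\<dots> = exp (9 + real n)" by (simp flip: exp_of_nat_mult)
  also have "\<dots> \<le> exp (Y n - Y i)" using Y_gap_less[OF assms] by simp
  finally have e: "2 ^ (9 + n) \<le> exp (Y n - Y i)" .
  have "W n * 2 ^ (9 + n) \<le> exp (- Y n) * exp (Y n - Y i)"
    using W_bounds(2)[of n] e by (intro mult_mono) auto
  also have "\<dots> = exp (- Y i)" by (simp flip: exp_add)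
  also have "\<dots> \<le> 2 * W i" using W_bounds(1)[of i] by simp
  also have "(2::real) ^ (9 + n) = 2 * 2 ^ (8 + n)" by (simp add: power_add)
  finally show ?thesis by (simp add: field_simps)
qed

lemma W_small:
  assumes "i < n" "3 \<le> n"
  shows "1000 * W n \<le> W i"
proof -
  have "(1000::real) \<le> 2 ^ (8 + 3)" by simp
  also have "\<dots> \<le> 2 ^ (8 + n)" using assms by (intro power_increasing) auto
  finally have "W n * 1000 \<le> W n * 2 ^ (8 + n)" using W_pos[of n] by (intro mult_left_mono) auto
  also have "\<dots> \<le> W i" using W_ratio[OF assms] by (simp add: field_simps)
  finally show ?thesis by (simp add: mult.commute)
qed

lemma c_bounds:
  assumes "3 \<le> n"
  shows "exp (Y n - Y (old n)) / 2 \<le> c n" "c n \<le> 2 * exp (Y n - Y (old n))" "2 \<le> c n"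
proof -
  define T where "T = exp (Y n) * W (old n)"
  have o: "exp (Y n - Y (old n)) / 2 \<le> T" "T \<le> exp (Y n - Y (old n))" unfolding T_def exp_diff
    using mult_left_mono[OF W_bounds(1)[of "old n"], of "exp (Y n)"]
      mult_left_mono[OF W_bounds(2)[of "old n"], of "exp (Y n)"] by (simp_all add: exp_minus field_simps)
  have "12 \<le> exp (Y n - Y (old n))"
    using Y_gap_less[OF old_less[of n]] assms exp_ge_add_one_self[of "Y n - Y (old n)"] by linarith
  with o have T: "6 \<le> T" by simp
  show "exp (Y n - Y (old n)) / 2 \<le> c n" "c n \<le> 2 * exp (Y n - Y (old n))" "2 \<le> c n"
    using o T ceiling_le_double[of T] le_of_int_ceiling[of T] unfolding c_def T_def[symmetric]
    by linarith+
qed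

lemma Z_init: "n < 3 \<Longrightarrow> Z n = (0, - shape n)" "Z 3 = (1, 0)"
  by (simp_all add: Z.simps)

lemma q_less:
  assumes "3 \<le> n" "i < n"
  shows "0 \<le> fst (Z i)" "fst (Z i) < fst (Z n)"
proof -
  have "\<forall>i<n. 0 \<le> fst (Z i) \<and> fst (Z i) < fst (Z n)" using assms(1)
  proof (induction n rule: dec_induct)
    case base
    then show ?case by (simp add: Z_init)
  next
    case (step n)
    have old: "fst (Z (old n)) < fst (Z n)" "0 \<le> fst (Z (old n))" using step old_less[of n] by auto
    have "2 * fst (Z n) \<le> c n * fst (Z n)" using c_bounds(3)[of n] step old by (intro mult_right_mono) auto
    then have "fst (Z n) < fst (Z (Suc n))"
      using old step.hyps unfolding Z_Suc(1)[OF step.hyps(1)] by linarith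
    then show ?case using step.IH old by (fastforce simp: less_Suc_eq)
  qed
  then show "0 \<le> fst (Z i)" "fst (Z i) < fst (Z n)" using assms by auto
qed

lemma q_pos: "3 \<le> n \<Longrightarrow> 0 < fst (Z n)"
  using q_less[of n 0] by (simp add: Z_init)

text \<open>\<open>c n\<close> agrees with \<open>exp (Y n - Y (old n))\<close> up to a factor 2,
  and subtracting the old denominator loses at most half. The remaining factor lies between 1/4 and
  2, and \<open>ln 4 \<le> 2\<close>.\<close>

lemma ln_q_step:
  assumes "3 \<le> n"
  shows "\<bar>ln (fst (Z (Suc n))) - ln (fst (Z n)) - (Y n - Y (old n))\<bar> \<le> 2"
proof -
  define E where "E = exp (Y n - Y (old n))"
  define qn where "qn = real_of_int (fst (Z n))"
  note c = c_bounds[OF assms, folded E_def]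
  have q: "0 < qn" using q_pos[OF assms] by (simp add: qn_def)
  have o: "0 \<le> fst (Z (old n))" "fst (Z (old n)) \<le> fst (Z n)"
    using q_less[OF assms old_less[OF assms]] by auto
  have "real_of_int (fst (Z (Suc n))) = c n * qn - fst (Z (old n))"
    using assms by (simp add: Z_Suc qn_def)
  then have b: "real_of_int (fst (Z (Suc n))) \<le> c n * qn" "c n * qn - qn \<le> real_of_int (fst (Z (Suc n)))"
    using o by (auto simp: qn_def)
  have "2 * qn \<le> c n * qn" using q c(3) by (intro mult_right_mono) auto
  then have "c n * qn / 2 \<le> real_of_int (fst (Z (Suc n)))" using b by linarith
  moreover have "E / 2 * qn \<le> c n * qn" "c n * qn \<le> 2 * E * qn"
    using q c by (intro mult_right_mono; simp)+
  ultimately have b: "E / 4 * qn \<le> fst (Z (Suc n))" "fst (Z (Suc n)) \<le> 2 * E * qn"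
    using b(1) by linarith+
  have E: "0 < E" by (simp add: E_def)
  have "ln (E / 4 * qn) \<le> ln (fst (Z (Suc n)))" "ln (fst (Z (Suc n))) \<le> ln (2 * E * qn)"
    using b E q q_pos[of "Suc n"] assms by (subst ln_le_cancel_iff; simp)+
  moreover have "ln (E / 4 * qn) = Y n - Y (old n) - ln 4 + ln qn" "ln (2 * E * qn) = Y n - Y (old n) + ln 2 + ln qn"
    using E q by (simp_all add: ln_mult ln_div) (simp_all add: E_def)
  moreover have "ln 4 \<le> (2::real)" "ln 2 \<le> (2::real)"
    using ln_le_minus_one[of 2] ln_mult[of 2 "2::real"] by simp_all
  ultimately show ?thesis unfolding qn_def by linarith
qed

section \<open>Errors of the vectors and the limit point\<close>

abbreviation V :: "real ^ 3 \<Rightarrow> nat \<Rightarrow> real ^ 3" where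
  "V \<alpha> n \<equiv> err \<alpha> (fst (Z n)) (snd (Z n))"

lemma V_init: "n < 3 \<Longrightarrow> V \<alpha> n = real_shape n" "V \<alpha> 3 = \<alpha>"
  by (auto simp: Z_init err_def real_shape_def vec_eq_iff)

lemma V_Suc:
  assumes "3 \<le> n"
  shows "V \<alpha> (Suc n) = c n *\<^sub>R V \<alpha> n - V \<alpha> (old n)"
  using assms by (simp add: Z_Suc err_def vec_eq_iff algebra_simps)

text \<open>The recursion is solved for the error at \<open>n\<close>. Since
  \<open>W n = W (old n) / c n\<close>, the scaled old error enters with coefficient exactly 1, and
  the next one with a tiny coefficient.\<close>

lemma V_scaled_step:
  assumes "3 \<le> n"
  shows "V \<alpha> n /\<^sub>R W n = V \<alpha> (old n) /\<^sub>R W (old n)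
    + (W (Suc n) / W (old n)) *\<^sub>R (V \<alpha> (Suc n) /\<^sub>R W (Suc n))"
proof -
  have p: "0 < W n" "0 < W (old n)" "0 < W (Suc n)" by (rule W_pos)+
  have "W n = W (old n) / c n" using assms by (simp add: W.simps[of n] c_def)
  then have "c n / W (old n) = 1 / W n" using p by auto
  moreover have "V \<alpha> (old n) + V \<alpha> (Suc n) = c n *\<^sub>R V \<alpha> n" using V_Suc[OF assms, of \<alpha>] by simp
  then have "(1 / W (old n)) *\<^sub>R (V \<alpha> (old n) + V \<alpha> (Suc n)) = (c n / W (old n)) *\<^sub>R V \<alpha> n" by simp
  moreover have "(W (Suc n) / W (old n)) *\<^sub>R (V \<alpha> (Suc n) /\<^sub>R W (Suc n)) = V \<alpha> (Suc n) /\<^sub>R W (old n)"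
    using p by (simp add: inverse_eq_divide)
  ultimately show ?thesis by (simp only: scaleR_add_right divide_inverse mult_1_left)
qed

text \<open>Along the chain of \<open>old\<close> down to a starting vector each index
  \<open>n\<close> adds at most \<open>S / 2 ^ (9 + n)\<close>. The factor
  \<open>1 - 1 / 2 ^ n\<close> records this sum: \<open>old n < n\<close> leaves room for the new
  term.\<close>

lemma V_close_if_bounded:
  assumes S: "\<And>n. n \<le> N \<Longrightarrow> norm (V \<alpha> n /\<^sub>R W n) \<le> S" and "n < N"
  shows "norm (V \<alpha> n /\<^sub>R W n - real_shape (cls n)) \<le> S / 2 ^ 9 * (1 - 1 / 2 ^ n)"
  using \<open>n < N\<close>
proof (induction n rule: less_induct)
  case (less n)
  have S0: "0 \<le> S" using S[of 0] norm_ge_zero order_trans by blast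
  show ?case
  proof (cases "n < 3")
    case True
    have "(1::real) / 2 ^ n \<le> 1" by (simp add: field_simps)
    then show ?thesis using True S0 by (simp add: W.simps[of n] cls_init V_init)
  next
    case False
    then have n: "3 \<le> n" by simp
    let ?D = "\<lambda>n. V \<alpha> n /\<^sub>R W n - real_shape (cls n)"
    let ?eta = "W (Suc n) / W (old n)"
    have o: "old n < n" using old_less n by simp
    have "?D n = ?D (old n) + ?eta *\<^sub>R (V \<alpha> (Suc n) /\<^sub>R W (Suc n))"
      unfolding V_scaled_step[OF n, of \<alpha>] using False by (simp add: cls_old)
    then have "norm (?D n) \<le> norm (?D (old n)) + \<bar>?eta\<bar> * norm (V \<alpha> (Suc n) /\<^sub>R W (Suc n))"
      by (metis norm_scaleR norm_triangle_ineq)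
    also have "norm (?D (old n)) \<le> S / 2 ^ 9 * (1 - 1 / 2 ^ old n)"
      using less o by simp
    also have "\<dots> \<le> S / 2 ^ 9 * (1 - 2 / 2 ^ n)"
    proof -
      have "(2::real) ^ Suc (old n) \<le> 2 ^ n" using o by (intro power_increasing) auto
      then have "(2::real) / 2 ^ n \<le> 1 / 2 ^ old n" by (simp add: field_simps)
      then show ?thesis using S0 by (intro mult_left_mono) auto
    qed
    also have "\<bar>?eta\<bar> * norm (V \<alpha> (Suc n) /\<^sub>R W (Suc n)) \<le> 1 / 2 ^ (9 + n) * S"
    proof (intro mult_mono)
      have "W (Suc n) \<le> W (old n) / 2 ^ (8 + Suc n)" using o n by (intro W_ratio) auto
      then have "?eta \<le> 1 / 2 ^ (9 + n)" using W_pos[of "old n"] by (simp add: field_simps)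
      then show "\<bar>?eta\<bar> \<le> 1 / 2 ^ (9 + n)" using W_pos[of "old n"] W_pos[of "Suc n"] by simp
      show "norm (V \<alpha> (Suc n) /\<^sub>R W (Suc n)) \<le> S" using S less by simp
    qed auto
    also have "S / 2 ^ 9 * (1 - 2 / 2 ^ n) + 1 / 2 ^ (9 + n) * S = S / 2 ^ 9 * (1 - 1 / 2 ^ n)"
      by (simp add: field_simps power_add)
    finally show ?thesis by simp
  qed
qed

text \<open>The largest scaled error occurs on both sides of the estimate; its contribution on the
  right has a small factor and can be absorbed.\<close>

lemma V_bounded_if_zero:
  assumes "V \<alpha> N = 0" "n \<le> N"
  shows "norm (V \<alpha> n /\<^sub>R W n) \<le> 4"
proof -
  let ?U = "\<lambda>n. norm (V \<alpha> n /\<^sub>R W n)"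
  define S where "S = Max (?U ` {..N})"
  have S: "?U n \<le> S" if "n \<le> N" for n unfolding S_def using that by (intro Max_ge) auto
  have S0: "0 \<le> S" using S[of 0] norm_ge_zero order_trans by blast
  have "?U m \<le> 3 + S / 2 ^ 9" if "m \<le> N" for m
  proof (cases "m = N")
    case True
    then show ?thesis using assms S0 by simp
  next
    case False
    then have "norm (V \<alpha> m /\<^sub>R W m - real_shape (cls m)) \<le> S / 2 ^ 9 * (1 - 1 / 2 ^ m)"
      using V_close_if_bounded[of N \<alpha> S m, OF S] that by simp
    also have "\<dots> \<le> S / 2 ^ 9" using S0 by (simp add: mult_left_le)
    finally show ?thesis
      using real_shape_norm(2)[of "cls m"] norm_triangle_sub[of "V \<alpha> m /\<^sub>R W m" "real_shape (cls m)"]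
      by linarith
  qed
  moreover have "S \<in> ?U ` {..N}" unfolding S_def by (intro Max_in) auto
  ultimately have "S \<le> 3 + S / 2 ^ 9" by auto
  then have "S \<le> 4" by simp
  then show ?thesis using S[OF assms(2)] by simp
qed

text \<open>The rational point \<open>A N\<close> annihilates the error with index
  \<open>N + 3\<close>, so \<open>V_bounded_if_zero\<close> bounds all earlier errors uniformly in
  \<open>N\<close>. Compactness gives a limit, to which each bound passes by continuity, and
  \<open>V_close_if_bounded\<close> with \<open>S = 4\<close> yields
  \<open>4 / 2 ^ 9 < 1 / 100\<close>.\<close>

lemma limit_point_exists:
  obtains \<alpha> where "\<And>n. norm (V \<alpha> n - W n *\<^sub>R real_shape (cls n)) \<le> W n / 100"
proof -
  define A where "A N = (\<chi> j. real_of_int (snd (Z (N + 3)) $ j) / of_int (fst (Z (N + 3))))" for N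
  have zero: "V (A N) (N + 3) = 0" for N
    using q_pos[of "N + 3"] by (simp add: A_def err_def vec_eq_iff)
  have b: "norm (V (A N) n) \<le> 4 * W n" if "n \<le> N + 3" for n N
    using V_bounded_if_zero[OF zero that] W_pos[of n] by (simp add: field_simps)
  have "norm (A N) \<le> 4 * W 3" for N using b[of 3 N] by (simp add: V_init)
  then have "bounded (range A)" by (auto intro: boundedI)
  from bounded_imp_convergent_subsequence[OF this] obtain \<alpha> r
    where r: "strict_mono r" and lim: "(A \<circ> r) \<longlonglongrightarrow> \<alpha>" by blast
  have U: "norm (V \<alpha> n /\<^sub>R W n) \<le> 4" for n
  proof -
    have e: "err \<beta> q a = of_int q *\<^sub>R \<beta> - (\<chi> j. of_int (a $ j))" for \<beta> q a
      by (simp add: err_def vec_eq_iff)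
    have "(\<lambda>N. norm (V ((A \<circ> r) N) n)) \<longlonglongrightarrow> norm (V \<alpha> n)"
      unfolding e by (intro tendsto_intros lim)
    moreover have "\<forall>N\<ge>n. norm (V ((A \<circ> r) N) n) \<le> 4 * W n"
    proof (intro allI impI)
      fix N assume "n \<le> N"
      then show "norm (V ((A \<circ> r) N) n) \<le> 4 * W n"
        using b[of n "r N"] seq_suble[OF r, of N] by simp
    qed
    ultimately have "norm (V \<alpha> n) \<le> 4 * W n" by (meson LIMSEQ_le_const2)
    then show ?thesis using W_pos[of n] by (simp add: field_simps)
  qed
  show ?thesis
  proof
    fix n
    have "norm (V \<alpha> n /\<^sub>R W n - real_shape (cls n)) \<le> 4 / 2 ^ 9 * (1 - 1 / 2 ^ n)"
      using V_close_if_bounded[of "Suc n" \<alpha> 4 n] U by simp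
    also have "\<dots> \<le> 4 / 2 ^ 9" by (simp add: mult_left_le)
    finally have "norm (V \<alpha> n /\<^sub>R W n - real_shape (cls n)) \<le> 1 / 100" by simp
    moreover have "V \<alpha> n - W n *\<^sub>R real_shape (cls n) = W n *\<^sub>R (V \<alpha> n /\<^sub>R W n - real_shape (cls n))"
      using W_pos[of n] by (simp add: scaleR_diff_right)
    ultimately show "norm (V \<alpha> n - W n *\<^sub>R real_shape (cls n)) \<le> W n / 100"
      using W_pos[of n] mult_left_mono[of _ "1/100" "W n"] by simp
  qed
qed

end

section \<open>Lattice bases and the spans of consecutive vectors\<close>

context regular_system begin

text \<open>Each step replaces \<open>Z (old n)\<close> by \<open>c n\<close> times
  \<open>Z n\<close> minus it. This exchange has an integral inverse, so integer coordinates carry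
  over by substitution.\<close>

lemma lattice_representation:
  assumes "3 \<le> n"
  shows "\<exists>u v s t. q = u * fst (Z n) + v * fst (Z (n - 1)) + s * fst (Z (n - 2)) + t * fst (Z (w n))
    \<and> a = u *s snd (Z n) + v *s snd (Z (n - 1)) + s *s snd (Z (n - 2)) + t *s snd (Z (w n))"
  using assms
proof (induction n rule: dec_induct)
  case base
  have "w 3 = 0" by (simp add: eval_nat_numeral)
  then have z: "Z 3 = (1, 0)" "Z (3 - 1) = (0, - shape 2)" "Z (3 - 2) = (0, - shape 1)" "Z (w 3) = (0, - shape 0)"
    by (simp_all add: Z_init)
  \<comment> \<open>The witnesses are the coordinates of \<open>a\<close> in the basis of negated
    shapes, by back substitution from the third component.\<close>
  show ?case unfolding z
    by (rule exI[of _ q], rule exI[of _ "- a $ 3"], rule exI[of _ "- a $ 2 - 2 * a $ 3"],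
        rule exI[of _ "- a $ 1 - a $ 2 - 3 * a $ 3"])
      (simp add: vec_eq_iff forall_3 shape_def)
next
  case (step n)
  then obtain u v s t where
    q: "q = u * fst (Z n) + v * fst (Z (n - 1)) + s * fst (Z (n - 2)) + t * fst (Z (w n))" and
    a: "a = u *s snd (Z n) + v *s snd (Z (n - 1)) + s *s snd (Z (n - 2)) + t *s snd (Z (w n))"
    by blast
  show ?case
  proof (cases "isB n")
    case True
    then have w: "w (Suc n) = n - 2" and o: "old n = w n" using step by (auto simp: old_def)
    have Zw: "fst (Z (w n)) = c n * fst (Z n) - fst (Z (Suc n))"
      "snd (Z (w n)) = c n *s snd (Z n) - snd (Z (Suc n))"
      using Z_Suc[of n] step o by auto
    show ?thesis unfolding q a w
      by (rule exI[of _ "- t"], rule exI[of _ "u + t * c n"], rule exI[of _ v], rule exI[of _ s])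
        (simp add: Zw vec_eq_iff algebra_simps numeral_2_eq_2)
  next
    case False
    then have w: "w (Suc n) = w n" and o: "old n = n - 2" by (auto simp: old_def)
    have Zo: "fst (Z (n - 2)) = c n * fst (Z n) - fst (Z (Suc n))"
      "snd (Z (n - 2)) = c n *s snd (Z n) - snd (Z (Suc n))"
      using Z_Suc[of n] step o by auto
    show ?thesis unfolding q a w Zo
      by (rule exI[of _ "- s"], rule exI[of _ "u + s * c n"], rule exI[of _ v], rule exI[of _ t])
        (simp add: vec_eq_iff algebra_simps)
  qed
qed

definition Zvec :: "nat \<Rightarrow> real \<times> (real ^ 3)" where
  "Zvec n = (of_int (fst (Z n)), \<chi> j. of_int (snd (Z n) $ j))"

lemma Zvec_Suc: "3 \<le> n \<Longrightarrow> Zvec (Suc n) = of_int (c n) *\<^sub>R Zvec n - Zvec (old n)"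
  by (simp add: Zvec_def Z_Suc vec_eq_iff)

lemma span_state:
  assumes "3 \<le> n"
  shows "span {Zvec n, Zvec (n - 1), Zvec (n - 2), Zvec (w n)} = UNIV"
proof -
  let ?S = "span {Zvec n, Zvec (n - 1), Zvec (n - 2), Zvec (w n)}"
  have int: "(of_int q, \<chi> j. of_int (a $ j)) \<in> ?S" for q a
  proof -
    obtain u v s t where
      q: "q = u * fst (Z n) + v * fst (Z (n - 1)) + s * fst (Z (n - 2)) + t * fst (Z (w n))" and
      a: "a = u *s snd (Z n) + v *s snd (Z (n - 1)) + s *s snd (Z (n - 2)) + t *s snd (Z (w n))"
      using lattice_representation[OF assms, of q a] by blast
    have "(real_of_int q, (\<chi> j. real_of_int (a $ j)) :: real ^ 3)
      = of_int u *\<^sub>R Zvec n + of_int v *\<^sub>R Zvec (n - 1) + of_int s *\<^sub>R Zvec (n - 2) + of_int t *\<^sub>R Zvec (w n)"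
      unfolding q a by (simp add: Zvec_def vec_eq_iff)
    also have "\<dots> \<in> ?S" by (intro span_add span_scale span_base) auto
    finally show ?thesis .
  qed
  have "Basis \<subseteq> ?S"
  proof
    fix b :: "real \<times> (real ^ 3)" assume "b \<in> Basis"
    then consider "b = (1, 0)" | j where "b = (0, axis j 1)"
      by (auto simp: Basis_prod_def Basis_vec_def)
    then show "b \<in> ?S"
    proof cases
      case 1
      then show ?thesis using int[of 1 0] by (simp add: zero_vec_def)
    next
      case 2
      have "(\<chi> i. real_of_int (axis j 1 $ i)) = (axis j 1 :: real ^ 3)"
        by (simp add: vec_eq_iff axis_def)
      then show ?thesis using 2 int[of 0 "axis j 1"] by simp
    qed
  qed
  then have "span Basis \<subseteq> ?S" by (rule span_minimal) (rule subspace_span)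
  then show ?thesis unfolding span_Basis by blast
qed

text \<open>Four vectors spanning a space of dimension four are independent. The second claim
  excludes a repetition, which the set in the first would hide.\<close>

lemma independent_state:
  assumes "3 \<le> n"
  shows "independent {Zvec n, Zvec (n - 1), Zvec (n - 2), Zvec (w n)}"
    "Zvec (w n) \<notin> {Zvec n, Zvec (n - 1), Zvec (n - 2)}"
proof -
  let ?B = "{Zvec n, Zvec (n - 1), Zvec (n - 2), Zvec (w n)}"
  have dim: "dim (UNIV :: (real \<times> (real ^ 3)) set) = 4" by simp
  have card: "card ?B \<le> 4"
    using card_length[of "[Zvec n, Zvec (n - 1), Zvec (n - 2), Zvec (w n)]"] by simp
  show ind: "independent ?B"
    using card_le_dim_spanning[of ?B UNIV] span_state[OF assms] dim card by simp
  have "card ?B = 4"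
    using ind span_state[OF assms] dim dim_span_eq_card_independent[OF ind] by simp
  moreover have "card ?B \<le> 3" if "Zvec (w n) \<in> {Zvec n, Zvec (n - 1), Zvec (n - 2)}"
  proof -
    have "?B = {Zvec n, Zvec (n - 1), Zvec (n - 2)}" using that by auto
    then show ?thesis using card_length[of "[Zvec n, Zvec (n - 1), Zvec (n - 2)]"] by simp
  qed
  ultimately show "Zvec (w n) \<notin> {Zvec n, Zvec (n - 1), Zvec (n - 2)}" by fastforce
qed

lemma independent_triple:
  assumes "3 \<le> n"
  shows "independent {Zvec n, Zvec (n - 1), Zvec (n - 2)}"
    "Zvec (w n) \<notin> span {Zvec n, Zvec (n - 1), Zvec (n - 2)}"
proof -
  have "{Zvec n, Zvec (n - 1), Zvec (n - 2), Zvec (w n)} = insert (Zvec (w n)) {Zvec n, Zvec (n - 1), Zvec (n - 2)}"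
    by auto
  then show "independent {Zvec n, Zvec (n - 1), Zvec (n - 2)}"
    "Zvec (w n) \<notin> span {Zvec n, Zvec (n - 1), Zvec (n - 2)}"
    using independent_state[OF assms] by (simp_all add: independent_insert)
qed

text \<open>In an A step the recursion relates exactly the four vectors involved, so each triple
  spans the other. In a B step equal spans would contain \<open>Zvec (w n)\<close>, against the
  independence of the basis.\<close>

lemma span_triple_eq_iff:
  assumes n: "3 \<le> n"
  shows "span {Zvec (n - 2), Zvec (n - 1), Zvec n} = span {Zvec (n - 1), Zvec n, Zvec (Suc n)} \<longleftrightarrow> \<not> isB n"
proof -
  let ?S = "span {Zvec (n - 2), Zvec (n - 1), Zvec n}" and ?S' = "span {Zvec (n - 1), Zvec n, Zvec (Suc n)}"
  note new = Zvec_Suc[OF n]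
  have oldv: "Zvec (old n) = of_int (c n) *\<^sub>R Zvec n - Zvec (Suc n)" using new by simp
  show ?thesis
  proof (cases "isB n")
    case True
    have "Zvec (w n) \<notin> ?S" using independent_triple(2)[OF n] by (simp add: insert_commute)
    moreover have "Zvec (w n) \<in> ?S" if "?S = ?S'"
    proof -
      have "Zvec (Suc n) \<in> ?S" unfolding that by (simp add: span_base)
      then show ?thesis using True oldv
        by (simp add: old_def) (intro span_diff span_scale, auto simp: span_base)
    qed
    ultimately show ?thesis using True by blast
  next
    case False
    then have o: "old n = n - 2" by (simp add: old_def)
    have "Zvec (Suc n) \<in> ?S" unfolding new o
      by (intro span_diff span_scale) (auto simp: span_base)
    moreover have "Zvec (n - 2) \<in> ?S'" unfolding oldv[unfolded o]
      by (intro span_diff span_scale) (auto simp: span_base)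
    ultimately have "?S = ?S'"
      by (intro subset_antisym span_minimal subspace_span) (auto simp: span_base)
    then show ?thesis using False by simp
  qed
qed

end

section \<open>Strict minimality of the vectors\<close>

locale regular_point = regular_system +
  fixes \<alpha> :: "real ^ 3"
  assumes close: "norm (V \<alpha> n - W n *\<^sub>R real_shape (cls n)) \<le> W n / 100"
begin

lemma V_bounds: "W n / 2 \<le> norm (V \<alpha> n)" "norm (V \<alpha> n) \<le> 4 * W n"
proof -
  have s: "norm (W n *\<^sub>R real_shape (cls n)) = W n * norm (real_shape (cls n))"
    using W_pos[of n] by simp
  have "W n \<le> W n * norm (real_shape (cls n))" "W n * norm (real_shape (cls n)) \<le> W n * 3"
    using W_pos[of n] real_shape_norm[of "cls n"] by auto
  then show "W n / 2 \<le> norm (V \<alpha> n)" "norm (V \<alpha> n) \<le> 4 * W n"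
    using close[of n] s W_pos[of n] norm_triangle_ineq2[of "V \<alpha> n" "W n *\<^sub>R real_shape (cls n)"]
      norm_triangle_ineq3[of "V \<alpha> n" "W n *\<^sub>R real_shape (cls n)"] by linarith+
qed

lemma V_decreasing:
  assumes "3 \<le> n" "i < n"
  shows "100 * norm (V \<alpha> n) \<le> norm (V \<alpha> i)"
  using V_bounds(2)[of n] V_bounds(1)[of i] W_small[OF assms(2,1)] W_pos[of i] by linarith

text \<open>The exact directions have inner product at most -1; deviations of 1/100 against norms up
  to 3 change it by at most 0.0601.\<close>

lemma V_inner_neg:
  assumes "3 \<le> n"
  shows "V \<alpha> (Suc n) \<bullet> V \<alpha> n < 0"
proof -
  define d where "d i = V \<alpha> i /\<^sub>R W i - real_shape (cls i)" for i
  have V: "V \<alpha> i = W i *\<^sub>R (real_shape (cls i) + d i)" for i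
    using W_pos[of i] by (simp add: d_def)
  have d: "norm (d i) \<le> 1 / 100" for i
  proof -
    have "W i * norm (d i) \<le> W i / 100"
      using close[of i] W_pos[of i] unfolding V[of i] by (simp add: scaleR_add_right)
    then show ?thesis using W_pos[of i] by (simp add: field_simps)
  qed
  let ?f = "real_shape (cls (Suc n))" and ?f' = "real_shape (cls n)"
  let ?d = "d (Suc n)" and ?d' = "d n"
  have "\<bar>?f \<bullet> ?d'\<bar> \<le> 3 * (1 / 100)"
    by (rule order_trans[OF Cauchy_Schwarz_ineq2]) (intro mult_mono real_shape_norm d, auto)
  moreover have "\<bar>?d \<bullet> ?f'\<bar> \<le> (1 / 100) * 3"
    by (rule order_trans[OF Cauchy_Schwarz_ineq2]) (intro mult_mono real_shape_norm d, auto)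
  moreover have "\<bar>?d \<bullet> ?d'\<bar> \<le> (1 / 100) * (1 / 100)"
    by (rule order_trans[OF Cauchy_Schwarz_ineq2]) (intro mult_mono d, auto)
  moreover have "?f \<bullet> ?f' \<le> -1" using classes_Suc_neq[OF assms] by (intro real_shape_inner)
  ultimately have "(?f + ?d) \<bullet> (?f' + ?d') < 0" by (simp add: inner_add_left inner_add_right)
  moreover have "V \<alpha> (Suc n) \<bullet> V \<alpha> n = (W (Suc n) * W n) * ((?f + ?d) \<bullet> (?f' + ?d'))"
    unfolding V by simp
  ultimately show ?thesis using W_pos[of n] W_pos[of "Suc n"] by (simp add: mult_pos_neg)
qed

text \<open>Comparing denominators gives \<open>\<bar>u\<bar> \<le> \<bar>v\<bar>\<close>. For
  \<open>\<bar>v\<bar> \<ge> 2\<close> the multiple of the error at \<open>n\<close> dominates, the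
  next error being 100 times smaller. Otherwise the range of \<open>q\<close> leaves only
  \<open>Z (Suc n) - Z n\<close>, and the obtuse angle applies.\<close>

lemma strictly_minimal_planar:
  assumes n: "3 \<le> n"
    and q: "q = u * fst (Z (Suc n)) + v * fst (Z n)" "1 \<le> q" "q < fst (Z (Suc n))"
    and ne: "\<not> (u = 0 \<and> v = 1)"
  shows "norm (V \<alpha> n) < norm (of_int u *\<^sub>R V \<alpha> (Suc n) + of_int v *\<^sub>R V \<alpha> n)"
proof -
  define Q where "Q = fst (Z (Suc n))"
  define Q' where "Q' = fst (Z n)"
  have Q: "0 < Q'" "Q' < Q" using q_pos[OF n] q_less[of "Suc n" n] n by (auto simp: Q_def Q'_def)
  have q: "q = u * Q + v * Q'" "1 \<le> q" "q < Q" using q by (auto simp: Q_def Q'_def)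
  have V: "0 < norm (V \<alpha> (Suc n))" "100 * norm (V \<alpha> (Suc n)) \<le> norm (V \<alpha> n)"
    using V_bounds(1)[of "Suc n"] W_pos[of "Suc n"] V_decreasing[of "Suc n" n] n by auto
  have v0: "v \<noteq> 0"
  proof
    assume "v = 0"
    then have "1 \<le> u * Q" "u * Q < 1 * Q" using q by auto
    then show False using Q by (auto simp: mult_less_cancel_right zero_less_mult_iff dest: less_le_trans[OF zero_less_one])
  qed
  have "\<bar>u\<bar> * Q = \<bar>q - v * Q'\<bar>" using q Q by (simp add: abs_mult)
  also have "\<dots> < Q + \<bar>v\<bar> * Q'"
    using q Q abs_triangle_ineq4[of q "v * Q'"] by (simp add: abs_mult)
  also have "\<dots> \<le> Q + \<bar>v\<bar> * Q" using Q by (simp add: mult_left_mono)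
  finally have "\<bar>u\<bar> * Q < (1 + \<bar>v\<bar>) * Q" by (simp add: algebra_simps)
  then have u: "\<bar>u\<bar> \<le> \<bar>v\<bar>" using Q by (simp add: mult_less_cancel_right)
  show ?thesis
  proof (cases "\<bar>v\<bar> \<ge> 2")
    case True
    have le: "norm (V \<alpha> (Suc n)) \<le> norm (V \<alpha> n)" using V by linarith
    have "2 * (norm (V \<alpha> n) - norm (V \<alpha> (Suc n))) \<le> of_int \<bar>v\<bar> * (norm (V \<alpha> n) - norm (V \<alpha> (Suc n)))"
      using True le by (intro mult_right_mono) auto
    also have "\<dots> \<le> of_int \<bar>v\<bar> * norm (V \<alpha> n) - of_int \<bar>u\<bar> * norm (V \<alpha> (Suc n))"
      using u by (simp add: right_diff_distrib mult_right_mono)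
    also have "\<dots> \<le> norm (of_int u *\<^sub>R V \<alpha> (Suc n) + of_int v *\<^sub>R V \<alpha> n)"
      using norm_diff_ineq[of "of_int v *\<^sub>R V \<alpha> n" "of_int u *\<^sub>R V \<alpha> (Suc n)"] by (simp add: add.commute)
    finally show ?thesis using V by argo
  next
    case False
    then have "v = 1 \<or> v = -1" "u = 0 \<or> u = 1 \<or> u = -1" using v0 u by linarith+
    then have uv: "v = -1" "u = 1" using q Q ne by auto
    have "norm (V \<alpha> (Suc n) - V \<alpha> n) ^ 2
        = norm (V \<alpha> (Suc n)) ^ 2 + norm (V \<alpha> n) ^ 2 - 2 * (V \<alpha> (Suc n) \<bullet> V \<alpha> n)"
      by (simp add: power2_norm_eq_inner inner_diff_left inner_diff_right inner_commute)
    then have "norm (V \<alpha> n) ^ 2 < norm (V \<alpha> (Suc n) - V \<alpha> n) ^ 2"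
      using V_inner_neg[OF n] zero_le_power2[of "norm (V \<alpha> (Suc n))"] by linarith
    then have "norm (V \<alpha> n) < norm (V \<alpha> (Suc n) - V \<alpha> n)"
      by (rule power_less_imp_less_base) simp
    then show ?thesis unfolding uv by simp
  qed
qed

text \<open>If \<open>Z (n - 1)\<close> or \<open>Z (w (Suc n))\<close> occurs, the coordinate along
  its class is at least \<open>1000 * W n\<close>. It cannot be cancelled: the two other classes are
  independent of it, and the error of \<open>Z (Suc n)\<close> is tiny. Otherwise the planar case
  applies.\<close>

lemma strictly_minimal:
  assumes n: "3 \<le> n" and q: "1 \<le> q" "q < fst (Z (Suc n))" and ne: "(q, a) \<noteq> Z n"
  shows "norm (V \<alpha> n) < norm (err \<alpha> q a)"
proof -
  obtain u v s t where
    qe: "q = u * fst (Z (Suc n)) + v * fst (Z n) + s * fst (Z (n - 1)) + t * fst (Z (w (Suc n)))" and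
    ae: "a = u *s snd (Z (Suc n)) + v *s snd (Z n) + s *s snd (Z (n - 1)) + t *s snd (Z (w (Suc n)))"
    using lattice_representation[of "Suc n" q a] n by (auto simp: numeral_2_eq_2)
  define k where "k = w (Suc n)"
  have kn: "k < n" using w_bound[of "Suc n"] n by (simp add: k_def)
  have E: "err \<alpha> q a = of_int u *\<^sub>R V \<alpha> (Suc n) + of_int v *\<^sub>R V \<alpha> n
      + of_int s *\<^sub>R V \<alpha> (n - 1) + of_int t *\<^sub>R V \<alpha> k"
    unfolding qe ae k_def by (simp add: err_def vec_eq_iff algebra_simps)
  show ?thesis
  proof (cases "s = 0 \<and> t = 0")
    case True
    have "\<not> (u = 0 \<and> v = 1)"
    proof
      assume "u = 0 \<and> v = 1"
      then have "q = fst (Z n)" "a = snd (Z n)" using True qe ae by (auto simp: vec_eq_iff)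
      then show False using ne by simp
    qed
    then show ?thesis using strictly_minimal_planar[OF n _ q] True qe E by simp
  next
    case False
    define x y z where "x = of_int v * W n" and "y = of_int s * W (n - 1)" and "z = of_int t * W k"
    define A where "A = max \<bar>x\<bar> (max \<bar>y\<bar> \<bar>z\<bar>)"
    have A: "\<bar>x\<bar> \<le> A" "\<bar>y\<bar> \<le> A" "\<bar>z\<bar> \<le> A" by (auto simp: A_def)
    define d where "d i = V \<alpha> i - W i *\<^sub>R real_shape (cls i)" for i
    have shape: "x *\<^sub>R real_shape (cls n) + y *\<^sub>R real_shape (cls (n - 1)) + z *\<^sub>R real_shape (cls k)
      = err \<alpha> q a - (of_int v *\<^sub>R d n + of_int s *\<^sub>R d (n - 1) + of_int t *\<^sub>R d k) - of_int u *\<^sub>R V \<alpha> (Suc n)"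
      unfolding E d_def x_def y_def z_def by (simp add: scaleR_diff_right)
    have dn: "norm (of_int e *\<^sub>R d i) \<le> \<bar>of_int e * W i\<bar> / 100" for e :: int and i
      using mult_left_mono[OF close[of i], of "\<bar>of_int e\<bar>"] W_pos[of i] by (simp add: d_def abs_mult)
    have cl: "{cls n, cls (n - 1), cls k} = {0, 1, 2}"
    proof -
      have "{cls n, cls (n - 1), cls k} = {cls k, cls (n - 1), cls n}" by auto
      then show ?thesis using classes[of "Suc n"] n by (simp add: k_def numeral_2_eq_2)
    qed
    have qs: "0 \<le> fst (Z i)" "fst (Z i) \<le> fst (Z (Suc n))" if "i < Suc n" for i
      using q_less[of "Suc n" i] n that by auto
    \<comment> \<open>The error of \<open>Z (Suc n)\<close> is too small to reveal the size of
      \<open>u\<close>; the first coordinates bound it instead.\<close>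
    have "\<bar>u\<bar> * fst (Z (Suc n)) \<le> (1 + \<bar>v\<bar> + \<bar>s\<bar> + \<bar>t\<bar>) * fst (Z (Suc n))"
    proof -
      have Qp: "0 < fst (Z (Suc n))" using q by simp
      have "\<bar>u\<bar> * fst (Z (Suc n)) = \<bar>u * fst (Z (Suc n))\<bar>" using Qp by (simp add: abs_mult)
      also have "\<dots> = \<bar>q - v * fst (Z n) - s * fst (Z (n - 1)) - t * fst (Z k)\<bar>"
        unfolding qe k_def by (simp add: algebra_simps)
      also have "\<dots> \<le> \<bar>q\<bar> + \<bar>v * fst (Z n)\<bar> + \<bar>s * fst (Z (n - 1))\<bar> + \<bar>t * fst (Z k)\<bar>" by linarith
      also have "\<dots> \<le> fst (Z (Suc n)) + \<bar>v\<bar> * fst (Z (Suc n)) + \<bar>s\<bar> * fst (Z (Suc n)) + \<bar>t\<bar> * fst (Z (Suc n))"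
        using q qs[of n] qs[of "n - 1"] qs[of k] kn n unfolding abs_mult
        by (intro add_mono mult_left_mono) auto
      finally show ?thesis by (simp add: algebra_simps)
    qed
    then have u: "\<bar>u\<bar> \<le> 1 + \<bar>v\<bar> + \<bar>s\<bar> + \<bar>t\<bar>" using q by simp
    have Wi: "\<bar>of_int e\<bar> * W (Suc n) \<le> \<bar>of_int e * W i\<bar> / 1000" if "i < Suc n" for e :: int and i
    proof -
      have "\<bar>of_int e\<bar> * (1000 * W (Suc n)) \<le> \<bar>of_int e\<bar> * W i"
        using W_small[of i "Suc n"] n that by (intro mult_left_mono) auto
      then show ?thesis using W_pos[of i] by (simp add: abs_mult)
    qed
    have "norm (of_int u *\<^sub>R V \<alpha> (Suc n)) \<le> of_int \<bar>u\<bar> * (4 * W (Suc n))"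
      using V_bounds(2)[of "Suc n"] by (simp add: mult_left_mono)
    also have "\<dots> \<le> of_int (1 + \<bar>v\<bar> + \<bar>s\<bar> + \<bar>t\<bar>) * (4 * W (Suc n))"
      using u W_pos[of "Suc n"] by (intro mult_right_mono, subst of_int_le_iff) simp_all
    also have "\<dots> = 4 * (W (Suc n) + \<bar>of_int v\<bar> * W (Suc n) + \<bar>of_int s\<bar> * W (Suc n) + \<bar>of_int t\<bar> * W (Suc n))"
      by (simp add: algebra_simps)
    also have "\<dots> \<le> 4 * (W n / 1000 + A / 1000 + A / 1000 + A / 1000)"
    proof -
      have "n < Suc n" "n - 1 < Suc n" "k < Suc n" using kn by auto
      from Wi[OF this(1), of v] Wi[OF this(2), of s] Wi[OF this(3), of t] show ?thesis
        using A W_small[of n "Suc n"] n unfolding x_def y_def z_def by simp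
    qed
    finally have un: "norm (of_int u *\<^sub>R V \<alpha> (Suc n)) \<le> W n / 250 + A * 12 / 1000" by simp
    have "norm (of_int v *\<^sub>R d n + of_int s *\<^sub>R d (n - 1) + of_int t *\<^sub>R d k) \<le> A * 3 / 100"
      using dn[of v n] dn[of s "n - 1"] dn[of t k] A
        norm_triangle_ineq[of "of_int v *\<^sub>R d n + of_int s *\<^sub>R d (n - 1)" "of_int t *\<^sub>R d k"]
        norm_triangle_ineq[of "of_int v *\<^sub>R d n" "of_int s *\<^sub>R d (n - 1)"]
      unfolding x_def y_def z_def by linarith
    \<comment> \<open>The terms in \<open>A\<close> on the right add up to \<open>0.21 * A\<close>.
      With \<open>A \<ge> 1000 * W n\<close> the error exceeds \<open>100 * W n\<close>, far above
      the bound \<open>4 * W n\<close> for the error at \<open>n\<close>.\<close>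
    then have "A \<le> 5 * (norm (err \<alpha> q a) + A * 3 / 100 + (W n / 250 + A * 12 / 1000))"
      using real_shape_coords[OF cl, of x y z] un unfolding shape A_def[symmetric]
      using norm_triangle_ineq4[of "err \<alpha> q a - (of_int v *\<^sub>R d n + of_int s *\<^sub>R d (n - 1) + of_int t *\<^sub>R d k)"
          "of_int u *\<^sub>R V \<alpha> (Suc n)"]
        norm_triangle_ineq4[of "err \<alpha> q a" "of_int v *\<^sub>R d n + of_int s *\<^sub>R d (n - 1) + of_int t *\<^sub>R d k"]
      by argo
    moreover have "1000 * W n \<le> A"
    proof -
      have big: "W i \<le> \<bar>of_int e * W i\<bar>" if "e \<noteq> 0" for e :: int and i
      proof -
        have "1 \<le> \<bar>real_of_int e\<bar>" using that by linarith
        then show ?thesis using W_pos[of i] by (simp add: abs_mult)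
      qed
      have "1000 * W n \<le> W (n - 1)" "1000 * W n \<le> W k" using W_small n kn by auto
      then show ?thesis using False big[of s "n - 1"] big[of t k] A
        unfolding y_def z_def by linarith
    qed
    ultimately show ?thesis using V_bounds(2)[of n] W_pos[of n] by argo
  qed
qed

end

section \<open>Patterns and exponents\<close>

context regular_point begin

lemma ln_V: "\<bar>- ln (norm (V \<alpha> n)) - Y n\<bar> \<le> 2"
proof -
  have v: "exp (- Y n) / 4 \<le> norm (V \<alpha> n)" "norm (V \<alpha> n) \<le> 4 * exp (- Y n)"
    using V_bounds[of n] W_bounds[of n] by linarith+
  have p: "0 < norm (V \<alpha> n)" using v(1) by (rule less_le_trans[rotated]) simp
  have "ln (exp (- Y n) / 4) \<le> ln (norm (V \<alpha> n))" "ln (norm (V \<alpha> n)) \<le> ln (4 * exp (- Y n))"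
    using v p by (subst ln_le_cancel_iff; simp)+
  moreover have "ln (exp (- Y n) / 4) = - Y n - ln 4" "ln (4 * exp (- Y n)) = ln 4 - Y n"
    by (simp_all add: ln_div ln_mult)
  moreover have "ln 4 \<le> (2::real)"
    using ln_le_minus_one[of 2] ln_mult[of 2 "2::real"] by simp
  ultimately show ?thesis by linarith
qed

text \<open>The shift by 3 drops the starting vectors, whose denominators are 0.\<close>

sublocale strictly_minimal_sequence \<alpha> "\<lambda>i. Z (i + 3)" "\<lambda>i. norm (V \<alpha> (i + 3))"
proof -
  show "strictly_minimal_sequence \<alpha> (\<lambda>i. Z (i + 3))"
  proof
    show "fst (Z (0 + 3)) = 1" by (simp add: Z_init)
    show "fst (Z (n + 3)) < fst (Z (Suc n + 3))" for n by (rule q_less) auto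
    show "norm (V \<alpha> (Suc n + 3)) < norm (V \<alpha> (n + 3))" for n
    proof -
      have "0 < norm (V \<alpha> (Suc n + 3))"
        using V_bounds(1)[of "Suc n + 3"] W_pos[of "Suc n + 3"] by linarith
      moreover have "100 * norm (V \<alpha> (Suc n + 3)) \<le> norm (V \<alpha> (n + 3))" by (rule V_decreasing) auto
        ultimately show ?thesis by linarith
    qed
    show "norm (V \<alpha> (n + 3)) < norm (err \<alpha> q a)"
      if "1 \<le> q" "q < fst (Z (Suc n + 3))" "(q, a) \<noteq> Z (n + 3)" for q n a
      using that by (intro strictly_minimal) auto
  qed
qed simp

lemma best_vec_eq: "best_vec \<alpha> n = Zvec (n + 3)"
  by (simp add: best_vec_def best_approx_eq Zvec_def)

lemma triple_eq: "triple \<alpha> (Suc n) = {Zvec (n + 3), Zvec (n + 4), Zvec (n + 5)}"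
  by (simp add: triple_def best_vec_eq add.commute eval_nat_numeral)

lemma good_indices_eq: "good_indices \<alpha> = {1..}"
proof -
  have "independent (triple \<alpha> n)" if n: "1 \<le> n" for n
  proof -
    obtain m where m: "n = Suc m" using n by (cases n) auto
    have e: "m + 5 - 1 = m + 4" "m + 5 - 2 = m + 3" by simp_all
    have "triple \<alpha> n = {Zvec (m + 5), Zvec (m + 5 - 1), Zvec (m + 5 - 2)}"
      unfolding m triple_eq e by blast
    then show ?thesis using independent_triple(1)[of "m + 5"] by simp
  qed
  then show ?thesis by (auto simp: good_indices_def)
qed

text \<open>All indices from 1 on are good, so letter \<open>i\<close> compares the triples at
  \<open>i + 1\<close> and \<open>i + 2\<close>. These end in \<open>Zvec (i + 5)\<close> and
  \<open>Zvec (i + 6)\<close>, and the step between them is governed by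
  \<open>isB (i + 5)\<close>.\<close>

lemma pattern_word_eq: "pattern_word \<alpha> i = (if isB (i + 5) then Letter_B else Letter_A)"
proof -
  have e: "enumerate {1::nat..} i = Suc i" for i
  proof (induction i)
    case 0
    show ?case by (simp add: enumerate_0 Least_equality)
  next
    case (Suc i)
    show ?case unfolding enumerate_Suc''[OF infinite_Ici] Suc.IH by (rule Least_equality) auto
  qed
  have "span (triple \<alpha> (Suc i)) = span (triple \<alpha> (Suc (i + 1))) \<longleftrightarrow> \<not> isB (i + 5)"
  proof -
    have e: "i + 5 - 2 = i + 3" "i + 5 - 1 = i + 4" "Suc (i + 5) = i + 1 + 5" "i + 1 + 3 = i + 4" "i + 1 + 4 = i + 5"
      by simp_all
    have "3 \<le> i + 5" by simp
    from span_triple_eq_iff[OF this] show ?thesis unfolding triple_eq e .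
  qed
  then show ?thesis unfolding pattern_word_def good_indices_eq e by simp
qed

text \<open>\<open>t n\<close> models the logarithm of the denominator, and minus the logarithm of
  the error is \<open>lam * t (Suc n)\<close> up to 2. Division by \<open>t (Suc n)\<close> gives
  the uniform exponent; division by \<open>t n\<close> brings in the quotients of \<open>t\<close>,
  whose largest value \<open>g\<close> recurs.\<close>

lemma exponents:
  fixes t :: "nat \<Rightarrow> real"
  assumes lim: "(\<lambda>n. ln (fst (Z n)) / t n) \<longlonglongrightarrow> 1" and t: "filterlim t at_top sequentially"
    and Y: "\<And>n. 3 \<le> n \<Longrightarrow> Y n = lam * t (Suc n)"
    and le: "\<And>n. t (Suc n) \<le> g * t n" and eq: "\<exists>\<^sub>F n in sequentially. t (Suc n) = g * t n"
    and pos: "0 < lam" "0 < g"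
  shows "omega_hat \<alpha> = ereal lam" "omega \<alpha> = ereal (lam * g)"
proof -
  have tpos: "\<forall>\<^sub>F n in sequentially. 0 < t n" using t by (simp add: filterlim_at_top_dense)
  have inv: "(\<lambda>n. c / t n) \<longlonglongrightarrow> 0" for c by (rule tendsto_divide_0[OF tendsto_const filterlim_at_top_imp_at_infinity[OF t]])
  have t': "filterlim (\<lambda>n. t (Suc n)) at_top sequentially"
    using t by (simp add: filterlim_sequentially_Suc)
  have "(\<lambda>n. - ln (norm (V \<alpha> n)) / t (Suc n) - lam) \<longlonglongrightarrow> 0"
  proof (rule Lim_null_comparison)
    show "(\<lambda>n. 2 / t (Suc n)) \<longlonglongrightarrow> 0" using LIMSEQ_Suc[OF inv[of 2]] .
    have "\<forall>\<^sub>F n in sequentially. 0 < t (Suc n)" using t' by (simp add: filterlim_at_top_dense)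
    then show "\<forall>\<^sub>F n in sequentially. norm (- ln (norm (V \<alpha> n)) / t (Suc n) - lam) \<le> 2 / t (Suc n)"
      using eventually_ge_at_top[of 3]
    proof eventually_elim
      case (elim n)
      then have "- ln (norm (V \<alpha> n)) / t (Suc n) - lam = (- ln (norm (V \<alpha> n)) - Y n) / t (Suc n)"
        by (simp add: Y field_simps)
      then show ?case using ln_V[of n] elim by (simp add: divide_right_mono)
    qed
  qed
  then have "(\<lambda>n. - ln (norm (V \<alpha> n)) / t (Suc n)) \<longlonglongrightarrow> lam" by (simp add: LIM_zero_iff)
  from tendsto_divide[OF this LIMSEQ_Suc[OF lim]]
  have "(\<lambda>n. - ln (norm (V \<alpha> n)) / t (Suc n) / (ln (fst (Z (Suc n))) / t (Suc n))) \<longlonglongrightarrow> lam" by simp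
  then have "(\<lambda>n. - ln (norm (V \<alpha> n)) / ln (fst (Z (Suc n)))) \<longlonglongrightarrow> lam"
  proof (rule Lim_transform_eventually)
    have "\<forall>\<^sub>F n in sequentially. 0 < t (Suc n)" using t' by (simp add: filterlim_at_top_dense)
    then show "\<forall>\<^sub>F n in sequentially. - ln (norm (V \<alpha> n)) / t (Suc n) / (ln (fst (Z (Suc n))) / t (Suc n))
        = - ln (norm (V \<alpha> n)) / ln (fst (Z (Suc n)))"
      by eventually_elim simp
  qed
  from LIMSEQ_ignore_initial_segment[OF this, of 3]
  show "omega_hat \<alpha> = ereal lam" using pos by (intro omega_hat_eq) simp_all
  \<comment> \<open>The additive constant absorbs the deviation 2 from \<open>ln_V\<close>, in both
    directions.\<close>
  have scaled: "(\<lambda>n. (\<gamma> * ln (fst (Z n)) + c) / t n) \<longlonglongrightarrow> \<gamma>" for \<gamma> c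
    using tendsto_add[OF tendsto_mult[OF tendsto_const lim, of \<gamma>] inv[of c]]
    by (simp add: add_divide_distrib)
  have upper: "\<forall>\<^sub>F n in sequentially. - ln (norm (V \<alpha> n)) < \<gamma> * ln (fst (Z n))" if "lam * g < \<gamma>" for \<gamma>
    using order_tendstoD(1)[OF scaled[of \<gamma> "-2"] that] tpos eventually_ge_at_top[of 3]
  proof eventually_elim
    case (elim n)
    have "- ln (norm (V \<alpha> n)) \<le> lam * t (Suc n) + 2" using ln_V[of n] Y[OF elim(3)] by linarith
    also have "lam * t (Suc n) \<le> lam * (g * t n)" using le pos by (intro mult_left_mono) auto
    also have "lam * (g * t n) < \<gamma> * ln (fst (Z n)) - 2" using elim by (simp add: field_simps)
    finally show ?case by simp
  qed
  have lower: "\<exists>\<^sub>F n in sequentially. \<gamma> * ln (fst (Z n)) < - ln (norm (V \<alpha> n))" if "\<gamma> < lam * g" for \<gamma>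
  proof (rule frequently_rev_mp[OF eq])
    show "\<forall>\<^sub>F n in sequentially. t (Suc n) = g * t n \<longrightarrow> \<gamma> * ln (fst (Z n)) < - ln (norm (V \<alpha> n))"
      using order_tendstoD(2)[OF scaled[of \<gamma> 2] that] tpos eventually_ge_at_top[of 3]
    proof eventually_elim
      case (elim n)
      have "\<gamma> * ln (fst (Z n)) + 2 < lam * (g * t n)" using elim by (simp add: field_simps)
      moreover have "lam * t (Suc n) - 2 \<le> - ln (norm (V \<alpha> n))" using ln_V[of n] Y[OF elim(3)] by linarith
      ultimately show ?case by auto
    qed
  qed
  show "omega \<alpha> = ereal (lam * g)"
  proof (rule omega_eq)
    show "\<forall>\<^sub>F n in sequentially. - ln (norm (V \<alpha> (n + 3))) < \<gamma> * ln (fst (Z (n + 3)))" if "lam * g < \<gamma>" for \<gamma>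
      using upper[OF that] by (subst eventually_sequentially_seg)
    show "\<exists>\<^sub>F n in sequentially. \<gamma> * ln (fst (Z (n + 3))) < - ln (norm (V \<alpha> (n + 3)))" if "\<gamma> < lam * g" for \<gamma>
      using lower[OF that] unfolding frequently_def by (subst eventually_sequentially_seg)
  qed (use pos in simp)
qed

end

section \<open>Denominators under a periodic choice of letters\<close>

context regular_system begin

text \<open>\<open>t\<close> satisfies exactly the recursion that the logarithms satisfy up to 2 per
  step (\<open>ln_q_step\<close>). The accumulated difference is linear in \<open>n\<close>, hence
  negligible against \<open>t\<close>.\<close>

lemma ln_q_asymptotic:
  fixes t :: "nat \<Rightarrow> real"
  assumes N: "3 \<le> N" and step: "\<And>n. N \<le> n \<Longrightarrow> Y n - Y (old n) = t (Suc n) - t n"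
    and t: "filterlim t at_top sequentially" and lim: "(\<lambda>n. real n / t n) \<longlonglongrightarrow> 0"
  shows "(\<lambda>n. ln (fst (Z n)) / t n) \<longlonglongrightarrow> 1"
proof -
  define C where "C = \<bar>ln (fst (Z N)) - t N\<bar>"
  have b: "\<bar>ln (fst (Z n)) - t n\<bar> \<le> C + 2 * real n" if "N \<le> n" for n
    using that
  proof (induction n rule: dec_induct)
    case base
    then show ?case by (simp add: C_def)
  next
    case (step n)
    then show ?case using ln_q_step[of n] assms(2)[of n] N by simp
  qed
  have "(\<lambda>n. ln (fst (Z n)) / t n - 1) \<longlonglongrightarrow> 0"
  proof (rule Lim_null_comparison)
    have "(\<lambda>n. C / t n + 2 * (real n / t n)) \<longlonglongrightarrow> 0 + 2 * 0"
      by (intro tendsto_add tendsto_mult tendsto_const lim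
          tendsto_divide_0[OF tendsto_const filterlim_at_top_imp_at_infinity[OF t]])
    then show "(\<lambda>n. (C + 2 * real n) / t n) \<longlonglongrightarrow> 0" by (simp add: add_divide_distrib)
    have "\<forall>\<^sub>F n in sequentially. 0 < t n" using t by (simp add: filterlim_at_top_dense)
    then show "\<forall>\<^sub>F n in sequentially. norm (ln (fst (Z n)) / t n - 1) \<le> (C + 2 * real n) / t n"
      using eventually_ge_at_top[of N]
    proof eventually_elim
      case (elim n)
      then have "ln (fst (Z n)) / t n - 1 = (ln (fst (Z n)) - t n) / t n" by (simp add: field_simps)
      then show ?case using b[of n] elim by (simp add: divide_right_mono)
    qed
  qed
  then show ?thesis by (simp add: LIM_zero_iff)
qed

text \<open>The last B step before \<open>n\<close> is at \<open>b = n - Suc k\<close>. It sets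
  \<open>w\<close> to \<open>b - 2\<close>, and the \<open>k\<close> A steps after it leave
  \<open>w\<close> unchanged.\<close>

lemma w_periodic:
  assumes "\<And>n. isB n \<longleftrightarrow> Suc k dvd n" "Suc k dvd n" "3 + Suc k \<le> n"
  shows "w n = n - Suc k - 2"
proof -
  define b where "b = n - Suc k"
  have b: "Suc k dvd b" "3 \<le> b" using assms by (auto simp: b_def)
  have "w (Suc b + j) = b - 2" if "j \<le> k" for j
    using that
  proof (induction j)
    case 0
    have "isB b" using b assms(1) by blast
    then show ?case using b by simp
  next
    case (Suc j)
    have "\<not> Suc k dvd Suc b + j"
    proof
      assume "Suc k dvd Suc b + j"
      then have "Suc k dvd Suc j" using b(1) dvd_add_right_iff[of "Suc k" b "Suc j"] by simp
      then show False using Suc.prems by (auto dest: dvd_imp_le)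
    qed
    then have "\<not> isB (Suc b + j)" using assms(1) by blast
    then show ?case using Suc by simp
  qed
  from this[of k] show ?thesis using assms(3) by (simp add: b_def)
qed

end

theorem theorem2:
  fixes k :: nat and lam :: real
  assumes "k \<ge> 1" and "lam \<in> {1/3 <..< 1}"
  shows "\<exists>\<alpha> :: real ^ 3.
           \<not> rational_point \<alpha> \<and> infinite (good_indices \<alpha>) \<and>
           ultimately_periodic (pattern_word \<alpha>) (replicate k Letter_A @ [Letter_B]) \<and>
           omega_hat \<alpha> = ereal lam \<and>
           omega \<alpha> / omega_hat \<alpha> = ereal (g_root k lam)"
proof -
  define g where "g = g_root k lam"
  define p where "p = Suc k"
  have g: "1 < g" using g_root_props(1)[OF assms] by (simp add: g_def)
  have lam: "0 < lam" using assms by simp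
  obtain x r where r: "1 < r" and x0: "x 0 = 1" and xr: "\<And>n. r * x n \<le> x (Suc n)"
    and xg: "\<And>n. x (Suc n) \<le> g * x n" and xB: "\<And>n. p dvd n \<Longrightarrow> x (Suc n) = g * x n"
    and relA: "\<And>n. \<not> p dvd n \<Longrightarrow> lam * (x (Suc n) - x (n - 1)) = x (Suc n) - x n"
    and relB: "\<And>n. p dvd n \<Longrightarrow> 2 * p \<le> n \<Longrightarrow> lam * (x (Suc n) - x (n - p - 1)) = x (Suc n) - x n"
    by (rule log_denominators_exist[OF assms, folded g_def p_def]) (rule that; assumption)
  have xpow: "r ^ n \<le> x n" for n
  proof (induction n)
    case (Suc n)
    have "r ^ Suc n \<le> r * x n" using Suc r by (simp add: mult_left_mono)
    then show ?case using xr[of n] by linarith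
  qed (simp add: x0)
  have xpos: "0 < x n" for n using xpow[of n] r by (intro less_le_trans[OF _ xpow]) simp
  \<comment> \<open>By Bernoulli's inequality \<open>x\<close> grows at least linearly, and so do
    its gaps; \<open>\<kappa>\<close> is a valid slope.\<close>
  define \<kappa> where "\<kappa> = (r - 1) * min 1 (r - 1)"
  have \<kappa>: "0 < \<kappa>" using r by (simp add: \<kappa>_def)
  have gap: "\<kappa> * (real n + 1) \<le> x (Suc n) - x n" for n :: nat
  proof -
    have "min 1 (r - 1) * (real n + 1) \<le> 1 + real n * (r - 1)"
      using mult_right_mono[of "min 1 (r - 1)" "r - 1" "real n"] by (simp add: algebra_simps) linarith
    also have "\<dots> \<le> x n"
      using Bernoulli_inequality[of "r - 1" n] r xpow[of n] by simp
    finally have "(r - 1) * (min 1 (r - 1) * (real n + 1)) \<le> (r - 1) * x n"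
      using r by (intro mult_left_mono) auto
    also have "\<dots> \<le> x (Suc n) - x n" using xr[of n] by (simp add: algebra_simps)
    finally show ?thesis by (simp add: \<kappa>_def mult.assoc)
  qed
  \<comment> \<open>The relations for \<open>x\<close> are homogeneous and survive scaling. The
    number 20 makes \<open>lam\<close> times the gaps of \<open>t\<close> exceed the growth
    \<open>10 + n\<close> demanded of \<open>Y\<close>.\<close>
  define X where "X = 20 / (lam * \<kappa>)"
  have X: "0 < X" "lam * X * \<kappa> = 20" using \<kappa> lam by (simp_all add: X_def)
  define t where "t n = X * x n" for n
  define Y where "Y n = (if n < 3 then 0 else lam * t (Suc n))" for n
  have tgap: "20 * (real n + 1) \<le> lam * (t (Suc n) - t n)" for n
  proof -
    have "(lam * X) * (\<kappa> * (real n + 1)) \<le> (lam * X) * (x (Suc n) - x n)"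
      using gap[of n] lam X by (intro mult_left_mono) auto
    then show ?thesis using X(2) by (simp add: t_def right_diff_distrib mult.assoc[symmetric])
  qed
  interpret regular_system "\<lambda>n. p dvd n" Y
  proof
    show "Y n = 0" if "n < 3" for n using that by (simp add: Y_def)
    show "Y n + 10 + real n \<le> Y (Suc n)" if "2 \<le> n" for n
    proof (cases "n = 2")
      case True
      have "0 \<le> lam * t 3" using lam X xpos[of 3] by (simp add: t_def)
      then show ?thesis using tgap[of 3] True by (simp add: Y_def right_diff_distrib eval_nat_numeral)
    next
      case False
      then show ?thesis using tgap[of "Suc n"] that by (simp add: Y_def right_diff_distrib)
    qed
  qed
  obtain \<alpha> where \<alpha>: "\<And>n. norm (V \<alpha> n - W n *\<^sub>R real_shape (cls n)) \<le> W n / 100"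
    by (rule limit_point_exists) (rule that; assumption)
  interpret regular_point "\<lambda>n. p dvd n" Y \<alpha>
    by unfold_locales (rule \<alpha>)
  have "(\<lambda>n. real n * (1 / r) ^ n) \<longlonglongrightarrow> 0"
    using r by (intro powser_times_n_limit_0) simp
  then have "(\<lambda>n. real n / x n) \<longlonglongrightarrow> 0"
  proof (rule Lim_null_comparison[rotated], intro always_eventually allI)
    fix n
    have "real n / x n \<le> real n / r ^ n"
      using xpow[of n] xpos[of n] r by (intro divide_left_mono) auto
    then show "norm (real n / x n) \<le> real n * (1 / r) ^ n"
      using xpos[of n] by (simp add: power_one_over)
  qed
  from tendsto_mult[OF tendsto_const[of "1 / X"] this]
  have nt: "(\<lambda>n. real n / t n) \<longlonglongrightarrow> 0" by (simp add: t_def mult.commute)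
  have t_top: "filterlim t at_top sequentially"
  proof -
    have "\<kappa> * real n \<le> x n" for n
    proof (cases n)
      case (Suc m)
      then show ?thesis using gap[of m] xpos[of m] by (simp add: add.commute)
    qed (simp add: x0)
    then have "X * \<kappa> * real n \<le> t n" for n
      using X mult_left_mono[of "\<kappa> * real n" "x n" X] by (simp add: t_def mult.assoc)
    moreover have "filterlim (\<lambda>n. X * \<kappa> * real n) at_top sequentially"
      using X \<kappa> by (intro filterlim_tendsto_pos_mult_at_top[OF tendsto_const _ filterlim_real_sequentially]) simp
    ultimately show ?thesis by (metis (no_types, lifting) always_eventually filterlim_at_top_mono)
  qed
  \<comment> \<open>From this index on \<open>old n \<ge> 3\<close>, so the default value 0 of
    \<open>Y\<close> is not met. \<open>Y (old n)\<close> involves \<open>x (Suc (old n))\<close>,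
    whence the indices \<open>n - 1\<close> and \<open>n - p - 1\<close> in the relations.\<close>
  have rel: "Y n - Y (old n) = t (Suc n) - t n" if n: "2 * p + 3 \<le> n" for n
  proof (cases "p dvd n")
    case True
    have "old n = n - p - 2" using True w_periodic[of k n, folded p_def] n by (simp add: old_def)
    moreover have "Suc (n - p - 2) = n - p - 1" "3 \<le> n - p - 2" using n assms(1) by (auto simp: p_def)
    ultimately have "Y n - Y (old n) = X * (lam * (x (Suc n) - x (n - p - 1)))"
      using n by (simp add: Y_def t_def algebra_simps)
    also have "lam * (x (Suc n) - x (n - p - 1)) = x (Suc n) - x n" using relB[OF True] n by simp
    finally show ?thesis by (simp add: t_def right_diff_distrib)
  next
    case False
    have "0 < p" by (simp add: p_def)
    then have "old n = n - 2" "Suc (n - 2) = n - 1" "3 \<le> n - 2" using False n by (auto simp: old_def)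
    then have "Y n - Y (old n) = X * (lam * (x (Suc n) - x (n - 1)))"
      using n by (simp add: Y_def t_def algebra_simps)
    also note relA[OF False]
    finally show ?thesis by (simp add: t_def right_diff_distrib)
  qed
  have ln_q: "(\<lambda>n. ln (fst (Z n)) / t n) \<longlonglongrightarrow> 1"
    by (rule ln_q_asymptotic[where N = "2 * p + 3", OF _ rel t_top nt]) simp_all
  have often: "\<exists>\<^sub>F n in sequentially. t (Suc n) = g * t n"
    unfolding frequently_sequentially
  proof
    fix n
    have "n \<le> p * n" by (simp add: p_def)
    moreover have "t (Suc (p * n)) = g * t (p * n)" using xB[of "p * n"] by (simp add: t_def)
    ultimately show "\<exists>m\<ge>n. t (Suc m) = g * t m" by blast
  qed
  have om: "omega_hat \<alpha> = ereal lam" "omega \<alpha> = ereal (lam * g)"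
  proof -
    have "t (Suc n) \<le> g * t n" for n
      using mult_left_mono[OF xg[of n], of X] X by (simp add: t_def mult.left_commute)
    moreover have "Y n = lam * t (Suc n)" if "3 \<le> n" for n using that by (simp add: Y_def)
    ultimately show "omega_hat \<alpha> = ereal lam" "omega \<alpha> = ereal (lam * g)"
      using exponents[OF ln_q t_top _ _ often lam] g by simp_all
  qed
  have "ultimately_periodic (pattern_word \<alpha>) (replicate k Letter_A @ [Letter_B])"
    unfolding ultimately_periodic_def
  proof (intro exI allI)
    fix j
    define i where "i = j mod p"
    have i: "i < p" by (simp add: i_def p_def)
    \<comment> \<open>The letter at position \<open>i\<close> depends on \<open>i + 5\<close>.
      Starting at \<open>5 * p - 4\<close> turns this into \<open>Suc j\<close> modulo
      \<open>p\<close>, so that exactly \<open>k\<close> letters A precede the first B.\<close>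
    have e: "5 * p - 4 + j + 5 = 5 * p + Suc j" by (simp add: p_def)
    have "p dvd 5 * p - 4 + j + 5 \<longleftrightarrow> p dvd Suc j" unfolding e by (rule dvd_add_right_iff) simp
    also have "\<dots> \<longleftrightarrow> i = k" unfolding i_def by (simp add: dvd_eq_mod_eq_0 mod_Suc p_def)
    finally have "pattern_word \<alpha> (5 * p - 4 + j) = (if i = k then Letter_B else Letter_A)"
      unfolding pattern_word_eq by simp
    also have "\<dots> = (replicate k Letter_A @ [Letter_B]) ! i"
      using i by (auto simp: nth_append p_def less_Suc_eq)
    finally show "pattern_word \<alpha> (5 * p - 4 + j)
      = (replicate k Letter_A @ [Letter_B]) ! (j mod length (replicate k Letter_A @ [Letter_B]))"
      by (simp add: i_def p_def)
  qed
  moreover have "infinite (good_indices \<alpha>)" unfolding good_indices_eq by (rule infinite_Ici)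
  moreover have "omega \<alpha> / omega_hat \<alpha> = ereal (g_root k lam)"
    unfolding om using lam by (simp flip: g_def)
  ultimately show ?thesis using not_rational om by blast
qed

end
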